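(* Let $G$ be any infinite network. If the wired uniform spanning forest of $G$ contains more than one two-ended component with positive probability, then it contains a component with three or more ends with positive probability.
   Context: A network is a locally finite, connected (multi)graph $G=(\mathsf V,\mathsf E)$ together with a function $c:\mathsf E\to(0,\infty)$ assigning a positive conductance $c(e)$ to each unoriented edge. Spanning trees and forests. For a finite network $H$, $\mathsf{UST}_H$ is the probability measure on spanning trees of $H$ for which the measure of a tree $t$ is proportional to $\prod_{e\in t}c(e)$. For an infinite network $G$, an exhaustion is an increasing sequence of finite subnetworks $G_n$ (subgraphs with inherited conductances) with $\bigcup_n G_n=G$. $G_n^*$ is the finite network obtained from $G$ by identifying all vertices of $G\setminus G_n$ into a single vertex $\partial_n$ and deleting all self-loops that are created. The wired uniform spanning forest measure $\mathsf{WUSF}_G$ is the weak limit of $\mathsf{UST}_{G_n^*}$: for each finite $S\subset\mathsf E$, $\mathsf{WUSF}_G(S\subseteq F)=\lim_{n\to\infty}\mathsf{UST}_{G_n^*}(S\subseteq T)$. The limit exists and does not depend on the exhaustion. It is supported on spanning forests (cycle-free subgraphs containing every vertex) all of whose components are infinite. The wired uniform spanning forest of $G$ is a random forest $F$ with law $\mathsf{WUSF}_G$. Ends. An infinite graph is $k$-ended if, over all finite sets of vertices $W$, the graph obtained by deleting $W$ has a maximum of $k$ distinct infinite connected components. It has three or more ends if deleting some finite set of vertices leaves at least three distinct infinite connected components. An infinite tree is two-ended iff it contains a unique simple bi-infinite path. *)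

theory Defs
  imports "HOL-Probability.Probability"
begin

section \<open>Multigraphs and networks\<close>

text \<open>
  Undirected multigraphs, with parallel edges and loops allowed: \<open>endpoints G e\<close> is the set of
  endpoints of the edge \<open>e\<close>, a singleton if \<open>e\<close> is a loop.
\<close>

record ('v, 'e) mgraph =
  verts :: "'v set"
  edges :: "'e set"
  endpoints :: "'e \<Rightarrow> 'v set"

locale multigraph =
  fixes G :: "('v, 'e) mgraph"
  assumes endpoints_verts: "e \<in> edges G \<Longrightarrow> \<exists>u \<in> verts G. \<exists>v \<in> verts G. endpoints G e = {u, v}"

definition adj :: "('v, 'e) mgraph \<Rightarrow> 'v rel" where
  "adj G = {(u, v). \<exists>e \<in> edges G. endpoints G e = {u, v}}"

definition linked :: "('v, 'e) mgraph \<Rightarrow> 'v rel" where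
  "linked G = {(u, v) \<in> verts G \<times> verts G. (u, v) \<in> (adj G)\<^sup>*}"

definition connected_graph :: "('v, 'e) mgraph \<Rightarrow> bool" where
  "connected_graph G \<longleftrightarrow> verts G \<noteq> {} \<and> (\<forall>u \<in> verts G. \<forall>v \<in> verts G. (u, v) \<in> linked G)"

text \<open>Connected components are represented by their vertex sets.\<close>

definition conn_components :: "('v, 'e) mgraph \<Rightarrow> 'v set set" where
  "conn_components G = verts G // linked G"

definition induced :: "('v, 'e) mgraph \<Rightarrow> 'v set \<Rightarrow> ('v, 'e) mgraph" where
  "induced G A = G\<lparr>verts := A, edges := {e \<in> edges G. endpoints G e \<subseteq> A}\<rparr>"

definition delete_verts :: "('v, 'e) mgraph \<Rightarrow> 'v set \<Rightarrow> ('v, 'e) mgraph" where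
  "delete_verts G W = induced G (verts G - W)"

definition spanning_subgraph :: "('v, 'e) mgraph \<Rightarrow> 'e set \<Rightarrow> ('v, 'e) mgraph" where
  "spanning_subgraph G F = G\<lparr>edges := F\<rparr>"

locale network = multigraph G for G :: "('v, 'e) mgraph" +
  fixes c :: "'e \<Rightarrow> real"
  assumes locally_finite: "v \<in> verts G \<Longrightarrow> finite {e \<in> edges G. v \<in> endpoints G e}"
    and connected: "connected_graph G"
    and conductance_pos: "e \<in> edges G \<Longrightarrow> c e > 0"


section \<open>Uniform spanning trees of finite networks\<close>

text \<open>A cycle of length 1 is a loop; a cycle of length 2 is a pair of distinct parallel edges.\<close>

definition is_cycle :: "('v, 'e) mgraph \<Rightarrow> 'v list \<Rightarrow> 'e list \<Rightarrow> bool" where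
  "is_cycle G vs es \<longleftrightarrow>
     es \<noteq> [] \<and> length vs = length es \<and> distinct vs \<and> distinct es \<and> set es \<subseteq> edges G \<and>
     (\<forall>i < length es. endpoints G (es ! i) = {vs ! i, vs ! (Suc i mod length es)})"

definition cycle_free :: "('v, 'e) mgraph \<Rightarrow> bool" where
  "cycle_free G \<longleftrightarrow> (\<nexists>vs es. is_cycle G vs es)"

definition spanning_trees :: "('v, 'e) mgraph \<Rightarrow> 'e set set" where
  "spanning_trees G =
     {t. t \<subseteq> edges G \<and> connected_graph (spanning_subgraph G t) \<and> cycle_free (spanning_subgraph G t)}"

definition ust :: "('v, 'e) mgraph \<Rightarrow> ('e \<Rightarrow> real) \<Rightarrow> 'e set measure" where
  "ust G c = point_measure (spanning_trees G)
     (\<lambda>t. ennreal ((\<Prod>e\<in>t. c e) / (\<Sum>t'\<in>spanning_trees G. \<Prod>e\<in>t'. c e)))"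


section \<open>The wired uniform spanning forest\<close>

definition subgraph :: "('v, 'e) mgraph \<Rightarrow> ('v, 'e) mgraph \<Rightarrow> bool" where
  "subgraph H G \<longleftrightarrow> multigraph H \<and> verts H \<subseteq> verts G \<and> edges H \<subseteq> edges G \<and>
     (\<forall>e \<in> edges H. endpoints H e = endpoints G e)"

definition exhaustion :: "('v, 'e) mgraph \<Rightarrow> (nat \<Rightarrow> ('v, 'e) mgraph) \<Rightarrow> bool" where
  "exhaustion G X \<longleftrightarrow>
     (\<forall>n. subgraph (X n) G \<and> finite (verts (X n)) \<and> finite (edges (X n))) \<and>
     (\<forall>n. subgraph (X n) (X (Suc n))) \<and>
     (\<Union>n. verts (X n)) = verts G \<and> (\<Union>n. edges (X n)) = edges G"

text \<open>
  The quotient of \<open>G\<close> in which all vertices outside \<open>H\<close> are identified into the boundary vertex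
  \<open>None\<close>. The loops at \<open>None\<close>, which are the edges of \<open>G\<close> with no endpoint in \<open>H\<close>, are deleted.
\<close>

definition wired :: "('v, 'e) mgraph \<Rightarrow> ('v, 'e) mgraph \<Rightarrow> ('v option, 'e) mgraph" where
  "wired G H =
     \<lparr>verts = insert None (Some ` verts H),
      edges = {e \<in> edges G. endpoints G e \<inter> verts H \<noteq> {}},
      endpoints = (\<lambda>e. (\<lambda>v. if v \<in> verts H then Some v else None) ` endpoints G e)\<rparr>"

definition edge_configs :: "('v, 'e) mgraph \<Rightarrow> 'e set measure" where
  "edge_configs G = sigma (Pow (edges G)) {{F \<in> Pow (edges G). e \<in> F} | e. e \<in> edges G}"

text \<open>
  \<open>M\<close> is the law of the wired uniform spanning forest of \<open>(G, c)\<close>. The limit exists and is the same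
  along all exhaustions, and the probabilities of the events \<open>S \<subseteq> F\<close> determine \<open>M\<close>.
\<close>

definition wusf_law :: "('v, 'e) mgraph \<Rightarrow> ('e \<Rightarrow> real) \<Rightarrow> 'e set measure \<Rightarrow> bool" where
  "wusf_law G c M \<longleftrightarrow>
     prob_space M \<and> sets M = sets (edge_configs G) \<and>
     (\<exists>X. exhaustion G X \<and>
        (\<forall>S. finite S \<and> S \<subseteq> edges G \<longrightarrow>
           (\<lambda>n. \<P>(T in ust (wired G (X n)) c. S \<subseteq> T)) \<longlonglongrightarrow> \<P>(F in M. S \<subseteq> F)))"


section \<open>Ends\<close>

text \<open>
  Deleting some finite set of vertices leaves at least \<open>k\<close> distinct infinite components. The set
  \<open>\<C>\<close> selects \<open>k\<close> of them, so that graphs with infinitely many are covered.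
\<close>

definition ends_at_least :: "nat \<Rightarrow> ('v, 'e) mgraph \<Rightarrow> bool" where
  "ends_at_least k G \<longleftrightarrow>
     (\<exists>W \<C>. W \<subseteq> verts G \<and> finite W \<and>
        \<C> \<subseteq> {C \<in> conn_components (delete_verts G W). infinite C} \<and> finite \<C> \<and> card \<C> = k)"

definition k_ended :: "nat \<Rightarrow> ('v, 'e) mgraph \<Rightarrow> bool" where
  "k_ended k G \<longleftrightarrow> infinite (verts G) \<and> ends_at_least k G \<and> \<not> ends_at_least (Suc k) G"

definition forest_components :: "('v, 'e) mgraph \<Rightarrow> 'e set \<Rightarrow> ('v, 'e) mgraph set" where
  "forest_components G F =
     induced (spanning_subgraph G F) ` conn_components (spanning_subgraph G F)"

end

theory Submission
  imports Defs
begin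

text \<open>
  Exchanging an edge changes the probability of a spanning tree only by a ratio of conductances:
  if \<open>f\<close> joins \<open>u\<close> and \<open>v\<close> and is not in a spanning tree \<open>T\<close>, then \<open>T + f - d\<close> is a spanning tree
  for some edge \<open>d\<close> at \<open>v\<close>, and \<open>T\<close> is recovered from it and \<open>d\<close>. Only finitely many edges are
  incident to \<open>v\<close>, so in the limit every event \<open>E\<close> of positive probability on which \<open>f\<close> is absent
  admits an edge \<open>d\<close> at \<open>v\<close> such that \<open>F + f - d\<close>, \<open>F \<in> E\<close>, is an event of positive probability.

  Suppose that \<open>x\<close> lies in a component with at least two ends, and \<open>y\<close> on a bi-infinite path of
  another one. Walk from \<open>x\<close> to \<open>y\<close> in \<open>G\<close> and attach each new vertex \<open>v\<close> to the component of \<open>x\<close> by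
  an exchange. Whichever edge \<open>d\<close> is removed at \<open>v\<close>, the component keeps its two ends. If the side
  of \<open>v\<close> in \<open>F - d\<close> is infinite, a third end is gained. If it is finite, then \<open>y\<close> is not in it and
  still lies on a bi-infinite path, so that the walk can continue. At \<open>y\<close> itself the side is infinite.
\<close>

section \<open>Reachability along a set of edges\<close>

definition reach :: "('e \<Rightarrow> 'v set) \<Rightarrow> 'e set \<Rightarrow> 'v \<Rightarrow> 'v \<Rightarrow> bool" where
  "reach g S a b \<longleftrightarrow> (a, b) \<in> {(u, v). \<exists>e\<in>S. g e = {u, v}}\<^sup>*"

text \<open>Deleting vertices is modelled by dropping every edge that meets \<open>W\<close>. The
  vertices of \<open>W\<close> stay behind as isolated points, so no vertex set has to be carried
  along.\<close>

definition off :: "('e \<Rightarrow> 'v set) \<Rightarrow> 'e set \<Rightarrow> 'v set \<Rightarrow> 'e set" where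
  "off g S W = {e \<in> S. g e \<inter> W = {}}"

definition unbounded :: "('e \<Rightarrow> 'v set) \<Rightarrow> 'e set \<Rightarrow> 'v \<Rightarrow> bool" where
  "unbounded g S a \<longleftrightarrow> infinite {b. reach g S a b}"

lemma reach_refl [simp]: "reach g S a a"
  by (simp add: reach_def)

lemma reach_trans [trans]: "reach g S a b \<Longrightarrow> reach g S b d \<Longrightarrow> reach g S a d"
  by (simp add: reach_def)

lemma reach_edge: "e \<in> S \<Longrightarrow> g e = {a, b} \<Longrightarrow> reach g S a b"
  unfolding reach_def by blast

lemma reach_induct [consumes 1, case_names refl step]:
  assumes "reach g S a b" "P a"
    "\<And>x y e. reach g S a x \<Longrightarrow> e \<in> S \<Longrightarrow> g e = {x, y} \<Longrightarrow> P x \<Longrightarrow> P y"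
  shows "P b"
  using assms(1)[unfolded reach_def]
proof (induction rule: rtrancl_induct)
  case (step y z)
  then show ?case using assms(3)[of y _ z] by (auto simp: reach_def)
qed (rule assms(2))

lemma reach_sym: "reach g S a b \<Longrightarrow> reach g S b a"
proof (induction rule: reach_induct)
  case (step x y e)
  then have "reach g S y x" by (intro reach_edge[of e]) (auto simp: insert_commute)
  then show ?case using step by (blast intro: reach_trans)
qed simp

lemma reach_common: "reach g S a b \<Longrightarrow> reach g S a d \<Longrightarrow> reach g S b d"
  by (rule reach_trans[OF reach_sym])

lemma reach_mono: "reach g S a b \<Longrightarrow> S \<subseteq> T \<Longrightarrow> reach g T a b"
proof (induction rule: reach_induct)
  case (step x y e)
  then show ?case by (blast intro: reach_trans reach_edge)
qed simp

lemma reach_far: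
  assumes "reach g S a b" "\<And>e. e \<in> S \<Longrightarrow> e \<notin> T \<Longrightarrow> \<exists>x\<in>g e. \<not> reach g S a x"
  shows "reach g T a b"
  using assms(1)
proof (induction rule: reach_induct)
  case (step x y e)
  have "reach g S a y" using step reach_edge[of e S g x y] by (blast intro: reach_trans)
  then have "e \<in> T" using step assms(2)[of e] by auto
  then show ?case using step by (blast intro: reach_trans reach_edge)
qed simp

text \<open>Only the first arrival at \<open>d\<close> and the last departure from it matter. If
  both happen at the same endpoint, \<open>d\<close> can be bypassed.\<close>

lemma reach_insert_cases:
  assumes "reach g (insert d S) a b" "g d = {v, z}"
  shows "reach g S a b \<or> reach g S a v \<and> reach g S z b \<or> reach g S a z \<and> reach g S v b"
  using assms(1)
proof (induction rule: reach_induct)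
  case (step x y e)
  show ?case
  proof (cases "e = d")
    case True
    then have "x = v \<and> y = z \<or> x = z \<and> y = v"
      using step assms(2) by (auto simp: doubleton_eq_iff)
    then show ?thesis using step.IH by auto
  next
    case False
    then have "reach g S x y" using step by (auto intro: reach_edge)
    then show ?thesis using step.IH by (blast intro: reach_trans)
  qed
qed simp

text \<open>Stop the walk at its first arrival at \<open>v\<close>. The final edge \<open>d\<close>
  becomes the removed edge in the exchange for spanning trees.\<close>

lemma reach_first_hit:
  assumes "reach g S u v" "u \<noteq> v"
  shows "\<exists>w d. reach g (off g S {v}) u w \<and> d \<in> S \<and> g d = {w, v}"
proof -
  have "reach g (off g S {v}) u b \<and> b \<noteq> v \<or> (\<exists>w d. reach g (off g S {v}) u w \<and> d \<in> S \<and> g d = {w, v})"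
    if "reach g S u b" for b
    using that
  proof (induction rule: reach_induct)
    case (step x y e)
    show ?case
    proof (cases "reach g (off g S {v}) u x \<and> x \<noteq> v \<and> y \<noteq> v")
      case True
      then have "e \<in> off g S {v}" using step by (auto simp: off_def)
      then show ?thesis using step True by (blast intro: reach_trans reach_edge)
    next
      case False
      then show ?thesis using step by blast
    qed
  qed (use assms in auto)
  then show ?thesis using assms by blast
qed

text \<open>Makes reachability a union of events \<open>K \<subseteq> F\<close> with
  \<open>K\<close> finite, hence measurable.\<close>

lemma reach_finite_subset:
  assumes "reach g S a b"
  shows "\<exists>K. finite K \<and> K \<subseteq> S \<and> reach g K a b"
  using assms
proof (induction rule: reach_induct)
  case (step x y e)
  then obtain K where K: "finite K" "K \<subseteq> S" "reach g K a x" by blast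
  have "reach g (insert e K) a x" using K by (auto intro: reach_mono)
  moreover have "reach g (insert e K) x y" using step by (auto intro: reach_edge)
  ultimately show ?case using K step
    by (intro exI[of _ "insert e K"]) (auto intro: reach_trans)
qed auto

lemma off_subset: "off g S W \<subseteq> S"
  by (auto simp: off_def)

lemma unbounded_mono: "unbounded g S a \<Longrightarrow> S \<subseteq> T \<Longrightarrow> unbounded g T a"
  unfolding unbounded_def by (erule infinite_super[rotated]) (auto intro: reach_mono)

lemma reach_off_eq:
  assumes "reach g (off g S W) a b" "a \<in> W"
  shows "b = a"
  using assms(1) by (induction rule: reach_induct) (use assms(2) in \<open>auto simp: off_def\<close>)

lemma unbounded_off_notin: "unbounded g (off g S W) a \<Longrightarrow> a \<notin> W"
proof
  assume u: "unbounded g (off g S W) a" and "a \<in> W"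
  then have "{b. reach g (off g S W) a b} \<subseteq> {a}" using reach_off_eq by fastforce
  then show False using u finite_subset unfolding unbounded_def by blast
qed

text \<open>Each piece left by removing \<open>u\<close> contains \<open>a\<close> or a neighbour of
  \<open>u\<close>. Finite degree leaves finitely many pieces, so one of them is infinite.\<close>

lemma unbounded_off_vertex:
  assumes fin: "finite {e \<in> S. u \<in> g e}" and unb: "unbounded g S a"
  shows "\<exists>a'. reach g S a a' \<and> unbounded g (off g S {u}) a'"
proof (rule ccontr)
  assume no: "\<not> ?thesis"
  let ?T = "off g S {u}"
  define N where "N = {w. reach g S a w \<and> (\<exists>e\<in>S. g e = {u, w})}"
  have "finite {w. g e = {u, w}}" for e
  proof (cases "\<exists>w. g e = {u, w}")
    case True
    then obtain w where "g e = {u, w}" by blast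
    then have "{w. g e = {u, w}} \<subseteq> {u, w}" by (auto simp: doubleton_eq_iff)
    then show ?thesis using finite_subset by blast
  qed simp
  then have "finite (\<Union>e\<in>{e \<in> S. u \<in> g e}. {w. g e = {u, w}})" using fin by (intro finite_UN_I)
  then have "finite N" by (rule finite_subset[rotated]) (auto simp: N_def)
  \<comment> \<open>Follow the walk from its last visit to \<open>u\<close>: the rest starts at a
    neighbour of \<open>u\<close>, or at \<open>a\<close> if there was no visit.\<close>
  have "b = u \<or> (\<exists>w\<in>insert a N. reach g ?T w b)" if "reach g S a b" for b
    using that
  proof (induction rule: reach_induct)
    case (step x y e)
    have y: "reach g S a y" using step by (blast intro: reach_trans reach_edge)
    consider "y = u" | "x = u" | "x \<noteq> u" "y \<noteq> u" by blast
    then show ?case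
    proof cases
      case 2
      then show ?thesis using step y by (metis (mono_tags, lifting) N_def insertI2 mem_Collect_eq reach_refl step(2,3))
    next
      case 3
      then have "e \<in> ?T" using step by (auto simp: off_def)
      then show ?thesis using step 3 by (blast intro: reach_trans reach_edge)
    qed auto
  qed auto
  then have "{b. reach g S a b} \<subseteq> insert u (\<Union>w\<in>insert a N. {b. reach g ?T w b})" by blast
  moreover have "finite (insert u (\<Union>w\<in>insert a N. {b. reach g ?T w b}))"
    using no \<open>finite N\<close> by (auto simp: unbounded_def N_def)
  ultimately show False using unb finite_subset unfolding unbounded_def by blast
qed

section \<open>Ends\<close>

text \<open>At least \<open>k\<close> ends: \<open>D\<close> holds one representative of each of
  \<open>k\<close> distinct infinite components left by deleting \<open>W\<close>. With
  representatives in place of component sets, both quantifiers range over finite vertex sets, which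
  suits measurability.\<close>

definition ends :: "nat \<Rightarrow> ('e \<Rightarrow> 'v set) \<Rightarrow> 'e set \<Rightarrow> 'v \<Rightarrow> bool" where
  "ends k g S x \<longleftrightarrow> (\<exists>W D. finite W \<and> (\<forall>w\<in>W. reach g S x w) \<and> finite D \<and> card D = k \<and>
     (\<forall>a\<in>D. reach g S x a \<and> unbounded g (off g S W) a) \<and>
     (\<forall>a\<in>D. \<forall>b\<in>D. reach g (off g S W) a b \<longrightarrow> a = b))"

text \<open>
  In an infinite tree these are the vertices on bi-infinite paths. Stated through the deletion of
  single edges, the notion makes sense in graphs with cycles, so that it is never needed that the
  random edge set is almost surely a forest.
\<close>

definition core :: "('e \<Rightarrow> 'v set) \<Rightarrow> 'e set \<Rightarrow> 'v \<Rightarrow> bool" where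
  "core g S y \<longleftrightarrow> (\<forall>d. unbounded g (S - {d}) y)"

lemma ends_reach:
  assumes "ends k g S x" "reach g S x y"
  shows "ends k g S y"
proof -
  have "reach g S y w" if "reach g S x w" for w
    using that assms(2) reach_sym reach_trans by metis
  moreover obtain W D where "finite W" "\<forall>w\<in>W. reach g S x w" "finite D" "card D = k"
    "\<forall>a\<in>D. reach g S x a \<and> unbounded g (off g S W) a"
    "\<forall>a\<in>D. \<forall>b\<in>D. reach g (off g S W) a b \<longrightarrow> a = b"
    using assms(1) unfolding ends_def by (elim exE conjE) (rule that)
  ultimately show ?thesis unfolding ends_def by (intro exI[of _ W] exI[of _ D]) blast
qed

lemma core_mono: "core g S y \<Longrightarrow> S \<subseteq> T \<Longrightarrow> core g T y"
  unfolding core_def by (meson Diff_mono subset_refl unbounded_mono[of g "S - {d}" y "T - {d}" for d])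

lemma ends_two_core:
  assumes two: "ends 2 g S x" and pair: "\<And>e. e \<in> S \<Longrightarrow> \<exists>u v. g e = {u, v}"
  shows "\<exists>y. reach g S x y \<and> core g S y"
  \<comment> \<open>If there is no such \<open>y\<close>, then every vertex \<open>y\<close> has a finite side \<open>?C y d\<close> of some bridge \<open>d\<close>.
    These sides grow until one contains \<open>W\<close>, but the other side of the bridge is connected.\<close>
proof (rule ccontr)
  assume no: "\<not> ?thesis"
  obtain W D where W: "finite W" "\<forall>w\<in>W. reach g S x w" and D: "card D = 2"
    "\<forall>a\<in>D. reach g S x a \<and> unbounded g (off g S W) a"
    "\<forall>a\<in>D. \<forall>b\<in>D. reach g (off g S W) a b \<longrightarrow> a = b"
    using two unfolding ends_def by (elim exE conjE) (rule that)
  obtain a b where ab: "a \<in> D" "b \<in> D" "a \<noteq> b"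
    using D(1) by (metis card_2_iff insertI1 insertI2)
  have "unbounded g S a" using D(2) ab off_subset unbounded_mono by metis
  moreover have "{b. reach g S a b} = {b. reach g S x b}"
    using D(2) ab reach_sym reach_trans by (metis (full_types))
  ultimately have inf: "infinite {b. reach g S x b}" by (simp add: unbounded_def)
  let ?P = "\<lambda>y d. reach g S x y \<and> finite {b. reach g (S - {d}) y b}"
  let ?C = "\<lambda>y d. {b. reach g (S - {d}) y b}"
  have ex: "\<exists>d. ?P y d" if "reach g S x y" for y
    using no that by (auto simp: core_def unbounded_def)
  \<comment> \<open>A finite side can be enlarged across any edge leaving it. Such an edge must be
    the bridge \<open>d\<close>, and a finite side of \<open>w\<close> then swallows the old
    side.\<close>
  have grow: "\<exists>y' d'. ?P y' d' \<and> ?C y d \<subseteq> ?C y' d' \<and> w \<in> ?C y' d'"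
    if P: "?P y d" and e: "e \<in> S" "g e = {z, w}" and z: "z \<in> ?C y d" for y d e z w
  proof (cases "w \<in> ?C y d")
    case False
    have "e = d"
    proof (rule ccontr)
      assume "e \<noteq> d"
      then have "reach g (S - {d}) z w" using e by (auto intro: reach_edge)
      then show False using z False by (blast intro: reach_trans)
    qed
    have yz: "reach g S y z" using z by (auto intro: reach_mono)
    have xz: "reach g S x z" using P yz by (blast intro: reach_trans)
    have xw: "reach g S x w" using xz e by (blast intro: reach_trans reach_edge)
    \<comment> \<open>\<open>d\<close> splits the component of \<open>x\<close> into two sides, so
      the side of \<open>w\<close> has to be infinite.\<close>
    have cover: "{b. reach g S x b} \<subseteq> ?C y d \<union> ?C w d"
    proof
      fix b assume "b \<in> {b. reach g S x b}"
      then have "reach g S z b" using xz reach_sym reach_trans by (metis mem_Collect_eq)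
      then have "reach g (insert d (S - {d})) z b" by (rule reach_mono) auto
      then have "reach g (S - {d}) z b \<or> reach g (S - {d}) w b"
        using reach_insert_cases[of g d "S - {d}" z b z w] e \<open>e = d\<close> by auto
      then show "b \<in> ?C y d \<union> ?C w d" using z by (auto intro: reach_trans)
    qed
    then have infw: "infinite (?C w d)" using inf P finite_subset by (metis finite_Un)
    obtain d' where d': "?P w d'" using ex[OF xw] by blast
    have "d' \<noteq> d" using infw d' by blast
    have wz: "reach g (S - {d'}) w z"
      by (rule reach_edge[of e]) (use e \<open>e = d\<close> \<open>d' \<noteq> d\<close> in \<open>auto simp: insert_commute\<close>)
    have far: "\<not> reach g (S - {d}) z w" using z False by (blast intro: reach_trans)
    \<comment> \<open>Since \<open>d'\<close> cuts an infinite side down to a finite one, it lies on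
      the side of \<open>w\<close>. The side of \<open>z\<close> therefore survives its removal and
      stays attached to \<open>w\<close> through \<open>d\<close>.\<close>
    have "\<exists>b. reach g (S - {d}) w b \<and> \<not> reach g (S - {d'}) w b"
      using d' infw finite_subset by (metis (mono_tags, lifting) mem_Collect_eq subsetI)
    then obtain b where b: "reach g (S - {d}) w b" "\<not> reach g (S - {d} - {d'}) w b"
      by (meson Diff_mono Diff_subset order_refl reach_mono)
    have d'w: "reach g (S - {d}) w p" if "p \<in> g d'" for p
      using reach_far[OF b(1), of "S - {d} - {d'}"] b(2) that by auto
    have "d' \<in> S" using b by (cases "d' \<in> S") auto
    then obtain p where "p \<in> g d'" using pair by blast
    then have p: "p \<in> g d'" "\<not> reach g (S - {d}) z p"
      using reach_trans[OF _ reach_sym[OF d'w]] far by blast+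
    have "reach g (S - {d'}) w b" if "reach g (S - {d}) z b" for b
    proof -
      have "reach g (S - {d} - {d'}) z b" by (rule reach_far[OF that]) (use p in auto)
      then have "reach g (S - {d'}) z b" by (rule reach_mono) auto
      then show ?thesis by (rule reach_trans[OF wz])
    qed
    moreover have "reach g (S - {d}) z b" if "b \<in> ?C y d" for b
      using that z by (auto intro: reach_common)
    ultimately show ?thesis using d' by (intro exI[of _ w] exI[of _ d']) auto
  qed (use P in blast)
  have cover_point: "\<exists>y' d'. ?P y' d' \<and> ?C y d \<subseteq> ?C y' d' \<and> w \<in> ?C y' d'"
    if P: "?P y d" and "reach g S y w" for y d w
    using that(2)
  proof (induction rule: reach_induct)
    case refl
    then show ?case using P by (intro exI[of _ y] exI[of _ d]) auto
  next
    case (step u v e)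
    then obtain y' d' where y': "?P y' d'" "?C y d \<subseteq> ?C y' d'" "u \<in> ?C y' d'" by blast
    obtain y'' d'' where y'': "?P y'' d''" "?C y' d' \<subseteq> ?C y'' d''" "v \<in> ?C y'' d''"
      using grow[OF y'(1) step(2,3) y'(3)] by blast
    then have "?C y d \<subseteq> ?C y'' d''" using y'(2) by (intro subset_trans[OF _ y''(2)])
    then show ?case using y'' by (intro exI[of _ y''] exI[of _ d'']) simp
  qed
  have "\<exists>y d. ?P y d \<and> W \<subseteq> ?C y d"
    using W
  proof (induction W rule: finite_induct)
    case empty
    obtain d where "?P x d" using ex[of x] by auto
    then show ?case by (intro exI[of _ x] exI[of _ d]) simp
  next
    case (insert w W)
    then have "\<exists>y d. ?P y d \<and> W \<subseteq> ?C y d" by simp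
    then obtain y d where y: "?P y d" "W \<subseteq> ?C y d" by (elim exE conjE) (rule that; simp)
    have "reach g S y w" using insert.prems y by (auto intro: reach_common[of g S x])
    from cover_point[OF y(1) this] obtain y' d' where
      y': "?P y' d'" "?C y d \<subseteq> ?C y' d'" "w \<in> ?C y' d'" by blast
    then have "insert w W \<subseteq> ?C y' d'" using y(2) by blast
    then show ?case using y' by (intro exI[of _ y'] exI[of _ d']) simp
  qed
  then obtain y d where y: "?P y d" "W \<subseteq> ?C y d" by (elim exE conjE) (rule that; simp)
  \<comment> \<open>The components represented by \<open>D\<close> are infinite, so each of them
    leaves the finite side containing \<open>W\<close>.\<close>
  have outside: "\<exists>p. reach g (off g S W) q p \<and> p \<notin> ?C y d" if "q \<in> D" for q
  proof -
    have "infinite {b. reach g (off g S W) q b}" using D(2) that by (simp add: unbounded_def)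
    then have "\<not> {b. reach g (off g S W) q b} \<subseteq> ?C y d" using y(1) finite_subset by blast
    then show ?thesis by blast
  qed
  obtain p where p: "reach g (off g S W) a p" "p \<notin> ?C y d" using outside ab by blast
  obtain q where q: "reach g (off g S W) b q" "q \<notin> ?C y d" using outside ab by blast
  have "reach g S x p"
    by (rule reach_trans[of g S x a]) (use D(2) ab p(1) reach_mono[OF _ off_subset] in auto)
  then have yp: "reach g S y p" using y by (auto intro: reach_common[of g S x])
  have "reach g S x q"
    by (rule reach_trans[of g S x b]) (use D(2) ab q(1) reach_mono[OF _ off_subset] in auto)
  then have pq: "reach g S p q" using \<open>reach g S x p\<close> by (auto intro: reach_common[of g S x])
  have "d \<in> S" using yp p(2) by (cases "d \<in> S") auto
  then obtain s t where st: "g d = {s, t}" using pair by blast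
  have "reach g (insert d (S - {d})) p q" "reach g (insert d (S - {d})) y p"
    using pq yp \<open>d \<in> S\<close> by (simp_all add: insert_absorb)
  then have c: "reach g (S - {d}) p q \<or> reach g (S - {d}) p s \<and> reach g (S - {d}) t q \<or>
      reach g (S - {d}) p t \<and> reach g (S - {d}) s q"
    "reach g (S - {d}) y p \<or> reach g (S - {d}) y s \<and> reach g (S - {d}) t p \<or>
      reach g (S - {d}) y t \<and> reach g (S - {d}) s p"
    by (auto dest: reach_insert_cases[where v=s and z=t] simp del: insert_Diff_single simp: st)
  have sym: "reach g (S - {d}) u v \<longleftrightarrow> reach g (S - {d}) v u" for u v
    using reach_sym by metis
  \<comment> \<open>Both \<open>p\<close> and \<open>q\<close> lie beyond \<open>d\<close>, in one
    connected piece that misses \<open>W\<close>; this joins \<open>a\<close> to \<open>b\<close>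
    off \<open>W\<close>.\<close>
  have "reach g (S - {d}) p q"
    using c p(2) q(2) sym reach_trans[of g "S - {d}"] by blast
  moreover have "\<not> reach g (S - {d}) p w" if "w \<in> W" for w
    using p(2) y(2) that sym by (auto dest: reach_trans)
  ultimately have "reach g (off g S W) p q"
    by (elim reach_far) (auto simp: off_def)
  then have "reach g (off g S W) a b" 
    using reach_trans[OF p(1)] reach_trans[OF _ reach_sym[OF q(1)]] by blast
  then show False using D(3) ab by blast
qed

text \<open>After any deletion of \<open>d'\<close>, removing \<open>d\<close> as well costs the
  component of \<open>y\<close> at most the piece of \<open>v\<close>, which is finite.\<close>

lemma core_remove_edge:
  assumes core: "core g F y" and d: "g d = {v, z}"
    and fin: "\<not> unbounded g (F - {d}) v" and far: "\<not> reach g (F - {d}) v y"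
  shows "core g (F - {d}) y"
  unfolding core_def
proof
  fix d'
  let ?S = "F - {d} - {d'}"
  have "reach g ?S y b \<or> reach g ?S v b" if "reach g (F - {d'}) y b" for b
  proof -
    have "reach g (insert d ?S) y b" using that by (rule reach_mono) auto
    moreover have "\<not> reach g ?S y v"
      using far reach_sym[OF reach_mono[of g ?S y v "F - {d}"]] by blast
    ultimately show ?thesis using reach_insert_cases[of g d ?S y b v z] d by blast
  qed
  then have "{b. reach g (F - {d'}) y b} \<subseteq> {b. reach g ?S y b} \<union> {b. reach g ?S v b}" by blast
  moreover have "infinite {b. reach g (F - {d'}) y b}" using core by (simp add: core_def unbounded_def)
  moreover have "\<not> unbounded g ?S v" using fin unbounded_mono[of g ?S v "F - {d}"] by blast
  ultimately show "unbounded g ?S y"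
    unfolding unbounded_def using finite_subset by blast
qed

text \<open>The deterministic part of one exchange: the side of \<open>v\<close> in
  \<open>F - {d}\<close> is hung on \<open>u\<close> by \<open>f\<close>. An infinite side supplies
  a further end once \<open>u\<close> is deleted too; a finite side harms neither the ends of the
  component nor the position of \<open>y\<close>.\<close>

lemma attach_end:
  assumes ends: "ends k g F u" and core: "core g F y" and uy: "\<not> reach g F u y" and uv: "\<not> reach g F u v"
    and d: "g d = {v, z}" and f: "g f = {u, v}" and lf: "finite {e \<in> F. u \<in> g e}"
    and F': "F' = insert f (F - {d})"
  shows "ends (Suc k) g F' v \<or> ends k g F' v \<and> core g F' y \<and> \<not> reach g F' v y"
proof -
  let ?F0 = "F - {d}"
  have F0: "?F0 \<subseteq> F" "?F0 \<subseteq> F'" using F' by auto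
  obtain W D where W: "finite W" "\<forall>w\<in>W. reach g F u w" and D: "finite D" "card D = k"
    "\<forall>a\<in>D. reach g F u a \<and> unbounded g (off g F W) a"
    "\<forall>a\<in>D. \<forall>b\<in>D. reach g (off g F W) a b \<longrightarrow> a = b"
    using ends unfolding ends_def by (elim exE conjE) (rule that)
  \<comment> \<open>\<open>v\<close> is an endpoint of \<open>d\<close>, so a component without
    \<open>v\<close> is not affected by the removal of \<open>d\<close>.\<close>
  have away: "reach g (T - {d}) a b" if "reach g T a b" "\<not> reach g T a v" for T a b
    by (rule reach_far[OF that(1)]) (use that(2) d in auto)
  have vu: "reach g F' v u" by (rule reach_edge[of f]) (use F' f in auto)
  have F'u: "reach g F' v b" if "reach g F u b" for b
    using reach_trans[OF vu reach_mono[OF away[OF that uv] F0(2)]] .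
  have off_d: "off g ?F0 W = off g F W - {d}" by (auto simp: off_def)
  have offF: "reach g F a b" if "reach g (off g F W) a b" for a b
    using that off_subset by (rule reach_mono)
  have nv: "\<not> reach g (off g F W) a v" if "a \<in> D" for a
    using that D(3) uv offF reach_trans by metis
  have off0: "reach g (off g ?F0 W) a b" if "a \<in> D" "reach g (off g F W) a b" for a b
    using away[OF that(2) nv[OF that(1)]] off_d by simp
  have unb0: "unbounded g (off g ?F0 W) a" if "a \<in> D" for a
  proof -
    have "{b. reach g (off g F W) a b} \<subseteq> {b. reach g (off g ?F0 W) a b}" using off0 that by blast
    moreover have "infinite {b. reach g (off g F W) a b}" using D(3) that by (simp add: unbounded_def)
    ultimately show ?thesis using finite_subset unfolding unbounded_def by blast
  qed
  have off_mono: "off g ?F0 W \<subseteq> off g F W" "off g ?F0 W \<subseteq> off g F' W"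
    using F0 by (auto simp: off_def)
  show ?thesis
  proof (cases "unbounded g ?F0 v")
    case True
    \<comment> \<open>Deleting \<open>u\<close> separates the side of \<open>v\<close> from the old
      component, but may split the components represented by \<open>D\<close>. Below,
      \<open>h\<close> moves each representative into an infinite piece.\<close>
    let ?W = "insert u W"
    have "finite {e \<in> off g ?F0 W. u \<in> g e}" by (rule finite_subset[OF _ lf]) (auto simp: off_def)
    then have "\<forall>a\<in>D. \<exists>a'. reach g (off g ?F0 W) a a' \<and> unbounded g (off g (off g ?F0 W) {u}) a'"
      by (intro ballI unbounded_off_vertex unb0)
    from bchoice[OF this] obtain h where
      "\<forall>a\<in>D. reach g (off g ?F0 W) a (h a) \<and> unbounded g (off g (off g ?F0 W) {u}) (h a)" ..
    then have h: "\<And>a. a \<in> D \<Longrightarrow> reach g (off g ?F0 W) a (h a)"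
      "\<And>a. a \<in> D \<Longrightarrow> unbounded g (off g (off g ?F0 W) {u}) (h a)" by simp_all
    have off1: "off g F' ?W = off g ?F0 ?W" "off g (off g ?F0 W) {u} = off g ?F0 ?W"
      using F' f by (auto simp: off_def)
    have same: "a = b" if "a \<in> D" "b \<in> D" "reach g (off g ?F0 ?W) (h a) (h b)" for a b
    proof -
      have "reach g (off g ?F0 W) (h a) (h b)" using that(3) by (rule reach_mono) (auto simp: off_def)
      then have "reach g (off g ?F0 W) a b"
        using reach_trans[OF h(1) reach_trans[OF _ reach_sym[OF h(1)]]] that by blast
      then have "reach g (off g F W) a b" using off_mono(1) by (rule reach_mono)
      then show ?thesis using D(4) that(1,2) by blast
    qed
    have hF: "reach g F u (h a)" if "a \<in> D" for a
    proof -
      have "reach g F a (h a)" using h(1)[OF that] by (rule reach_mono) (auto simp: off_def)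
      then show ?thesis using D(3) that reach_trans by metis
    qed
    have vh: "\<not> reach g (off g ?F0 ?W) (h a) v" if "a \<in> D" for a
    proof
      assume "reach g (off g ?F0 ?W) (h a) v"
      then have "reach g F (h a) v" by (rule reach_mono) (auto simp: off_def)
      then show False using hF[OF that] uv reach_trans by metis
    qed
    have "v \<notin> h ` D" using hF uv by auto
    moreover have "inj_on h D" using same by (auto intro!: inj_onI)
    ultimately have card: "card (insert v (h ` D)) = Suc k" using D by (simp add: card_image)
    \<comment> \<open>All of \<open>?W\<close> lies in the component of \<open>u\<close> in
      \<open>F\<close>, so its deletion leaves the side of \<open>v\<close> intact.\<close>
    have unbv: "unbounded g (off g ?F0 ?W) v"
    proof -
      have "\<not> reach g ?F0 v w" if "w \<in> ?W" for w
      proof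
        assume "reach g ?F0 v w"
        then have "reach g F w v" using reach_sym reach_mono[OF _ F0(1)] by metis
        moreover have "reach g F u w" using W that by auto
        ultimately show False using uv reach_trans by metis
      qed
      then have "reach g (off g ?F0 ?W) v b" if "reach g ?F0 v b" for b
        by (intro reach_far[OF that]) (auto simp: off_def)
      then have "{b. reach g ?F0 v b} \<subseteq> {b. reach g (off g ?F0 ?W) v b}" by blast
      then show ?thesis using True finite_subset unfolding unbounded_def by blast
    qed
    have "ends (Suc k) g F' v"
      unfolding ends_def
    proof (rule exI[of _ ?W], rule exI[of _ "insert v (h ` D)"], intro conjI ballI impI)
      show "reach g F' v w" if "w \<in> ?W" for w using that W F'u by auto
      show "reach g F' v a" if "a \<in> insert v (h ` D)" for a using that hF F'u by (cases "a = v") auto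
      show "unbounded g (off g F' ?W) a" if "a \<in> insert v (h ` D)" for a
        using that h unbv off1 by (cases "a = v") auto
      show "a = b" if "a \<in> insert v (h ` D)" "b \<in> insert v (h ` D)" "reach g (off g F' ?W) a b" for a b
      proof -
        have "reach g (off g ?F0 ?W) a b" "reach g (off g ?F0 ?W) b a"
          using that(3) off1 reach_sym by metis+
        then show ?thesis using that(1,2) vh same by auto
      qed
    qed (use W D card in auto)
    then show ?thesis ..
  next
    case False
    have nvy: "\<not> reach g ?F0 v y"
    proof
      assume vy: "reach g ?F0 v y"
      have "unbounded g ?F0 y" using core by (simp add: core_def)
      moreover have "{b. reach g ?F0 y b} \<subseteq> {b. reach g ?F0 v b}" using vy reach_trans by fast
      ultimately show False using False finite_subset unfolding unbounded_def by blast
    qed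
    have "core g F' y" using core_mono[OF core_remove_edge[OF core d False nvy] F0(2)] .
    moreover have "\<not> reach g F' v y"
    proof
      assume a: "reach g F' v y"
      have "reach g ?F0 v y \<or> reach g ?F0 v u \<and> reach g ?F0 v y \<or> reach g ?F0 v v \<and> reach g ?F0 u y"
        using a unfolding F' by (rule reach_insert_cases) (rule f)
      then have "reach g ?F0 u y" using nvy by blast
      then have "reach g F u y" using F0(1) by (rule reach_mono)
      then show False using uy by simp
    qed
    moreover have "ends k g F' v"
      unfolding ends_def
    proof (rule exI[of _ W], rule exI[of _ D], intro conjI ballI impI)
      show "unbounded g (off g F' W) a" if "a \<in> D" for a
        using unb0[OF that] off_mono(2) by (rule unbounded_mono)
      show "a = b" if "a \<in> D" "b \<in> D" "reach g (off g F' W) a b" for a b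
      proof -
        \<comment> \<open>\<open>f\<close> leads only to the side of \<open>v\<close>, which
          contains no representative, so it cannot join two of them.\<close>
        have "reach g (insert f (off g ?F0 W)) a b"
          using that(3) by (rule reach_mono) (auto simp: F' off_def)
        then have "reach g (off g ?F0 W) a b \<or> reach g (off g ?F0 W) a u \<and> reach g (off g ?F0 W) v b \<or>
          reach g (off g ?F0 W) a v \<and> reach g (off g ?F0 W) u b"
          by (rule reach_insert_cases) (rule f)
        moreover have "\<not> reach g (off g ?F0 W) v b"
        proof
          assume "reach g (off g ?F0 W) v b"
          then have "reach g F b v" using reach_sym reach_mono[OF _ off_mono(1)] offF by metis
          then show False using D(3) that uv reach_trans by metis
        qed
        moreover have "\<not> reach g (off g ?F0 W) a v"
          using nv[OF that(1)] reach_mono[of g _ a v, OF _ off_mono(1)] by blast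
        ultimately have "reach g (off g F W) a b" using reach_mono[of g _ a b, OF _ off_mono(1)] by blast
        then show ?thesis using D(4) that(1,2) by blast
      qed
    qed (use W D F'u in auto)
    ultimately show ?thesis by blast
  qed
qed

section \<open>Forest components as subgraphs and as reachability classes\<close>

lemma adj_spanning: "(a, b) \<in> (adj (spanning_subgraph G F))\<^sup>* \<longleftrightarrow> reach (endpoints G) F a b"
  by (simp add: adj_def spanning_subgraph_def reach_def)

lemma (in multigraph) reach_verts:
  assumes "F \<subseteq> edges G" "reach (endpoints G) F a b" "a \<in> verts G"
  shows "b \<in> verts G"
  using assms(2)
proof (induction rule: reach_induct)
  case (step x y e)
  have "e \<in> edges G" using step(2) assms(1) by blast
  then obtain u v where "u \<in> verts G" "v \<in> verts G" "endpoints G e = {u, v}"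
    using endpoints_verts by blast
  then show ?case using step(3) by (auto simp: doubleton_eq_iff)
qed (rule assms(3))

text \<open>Indexing by vertices, with repetitions, turns quantification over components into
  quantification over vertices, later countably many.\<close>

lemma (in multigraph) forest_components_eq:
  assumes "F \<subseteq> edges G"
  shows "forest_components G F =
    (\<lambda>x. induced (spanning_subgraph G F) {b. reach (endpoints G) F x b}) ` verts G"
proof -
  have "linked (spanning_subgraph G F) `` {x} = {b. reach (endpoints G) F x b}" if "x \<in> verts G" for x
    using that reach_verts[OF assms] by (auto simp: linked_def adj_spanning) (auto simp: spanning_subgraph_def)
  then have "conn_components (spanning_subgraph G F) = (\<lambda>x. {b. reach (endpoints G) F x b}) ` verts G"
    by (auto simp: conn_components_def quotient_def) (auto simp: spanning_subgraph_def)
  then show ?thesis by (auto simp: forest_components_def)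
qed

text \<open>A walk off \<open>W\<close> from \<open>a\<close> stays in \<open>C\<close> and never
  enters \<open>W\<close>, so restricting the edges to \<open>C - W\<close> loses none of
  it.\<close>

lemma linked_delete_verts:
  fixes G F x W
  defines "g \<equiv> endpoints G" and "C \<equiv> {b. reach (endpoints G) F x b}"
  assumes a: "a \<in> C - W"
  shows "linked (delete_verts (induced (spanning_subgraph G F) C) W) `` {a} = {b. reach g (off g F W) a b}"
proof -
  let ?A = "induced (spanning_subgraph G F) C"
  define S where "S = {e \<in> F. g e \<subseteq> C - W}"
  have adj: "adj (delete_verts ?A W) = {(u, v). \<exists>e\<in>S. g e = {u, v}}"
    by (auto simp: adj_def delete_verts_def induced_def spanning_subgraph_def S_def g_def)
  have C: "b \<in> C" if "reach g (off g F W) a b" for b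
    using that a reach_trans reach_mono[OF that off_subset] unfolding C_def g_def by fast
  have "reach g S a b \<longleftrightarrow> reach g (off g F W) a b" for b
  proof
    assume "reach g S a b"
    then show "reach g (off g F W) a b" by (rule reach_mono) (auto simp: S_def off_def)
  next
    assume "reach g (off g F W) a b"
    then show "reach g S a b"
    proof (rule reach_far)
      fix e assume "e \<in> off g F W" "e \<notin> S"
      then have "\<not> g e \<subseteq> C" by (auto simp: S_def off_def)
      then show "\<exists>x\<in>g e. \<not> reach g (off g F W) a x" using C by blast
    qed
  qed
  moreover have "b \<in> C - W" if "reach g (off g F W) a b" for b
    using C[OF that] reach_off_eq[OF reach_sym[OF that]] a by blast
  moreover have "verts (delete_verts ?A W) = C - W"
    by (simp add: delete_verts_def induced_def)
  ultimately show ?thesis using a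
    by (auto simp: linked_def adj reach_def[symmetric])
qed

text \<open>Choose a vertex in each selected component; conversely, take the components of the
  representatives. These lie outside \<open>W\<close> because vertices of \<open>W\<close> are
  isolated after the deletion.\<close>

lemma ends_at_least_iff:
  fixes G F x
  defines "g \<equiv> endpoints G"
  shows "ends_at_least k (induced (spanning_subgraph G F) {b. reach g F x b}) \<longleftrightarrow> ends k g F x"
proof -
  define C where "C = {b. reach g F x b}"
  let ?A = "induced (spanning_subgraph G F) C"
  let ?R = "\<lambda>W a. {b. reach g (off g F W) a b}"
  have comp: "conn_components (delete_verts ?A W) = ?R W ` (C - W)" for W
  proof -
    have "verts (delete_verts ?A W) = C - W" by (simp add: delete_verts_def induced_def)
    then show ?thesis using linked_delete_verts[of _ G F x W]
      by (auto simp: conn_components_def quotient_def C_def g_def)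
  qed
  have "ends_at_least k ?A \<longleftrightarrow> (\<exists>W \<C>. W \<subseteq> C \<and> finite W \<and>
        \<C> \<subseteq> {X \<in> ?R W ` (C - W). infinite X} \<and> finite \<C> \<and> card \<C> = k)"
    unfolding ends_at_least_def comp by (simp add: induced_def)
  also have "\<dots> \<longleftrightarrow> ends k g F x"
  proof
    assume "\<exists>W \<C>. W \<subseteq> C \<and> finite W \<and> \<C> \<subseteq> {X \<in> ?R W ` (C - W). infinite X} \<and> finite \<C> \<and> card \<C> = k"
    then obtain W \<C> where W: "W \<subseteq> C" "finite W" and \<C>: "\<C> \<subseteq> {X \<in> ?R W ` (C - W). infinite X}"
      "finite \<C>" "card \<C> = k" by blast
    have "\<forall>X\<in>\<C>. \<exists>a. a \<in> C - W \<and> X = ?R W a" using \<C>(1) by auto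
    from bchoice[OF this] obtain h where h: "\<forall>X\<in>\<C>. h X \<in> C - W \<and> X = ?R W (h X)" ..
    have inj: "X = Y" if "X \<in> \<C>" "Y \<in> \<C>" "reach g (off g F W) (h X) (h Y)" for X Y
    proof -
      have "?R W (h X) = ?R W (h Y)"
        using reach_common[OF that(3)] reach_trans[OF that(3)] by blast
      then show ?thesis using h that by metis
    qed
    then have "inj_on h \<C>" by (intro inj_onI) simp
    then have "card (h ` \<C>) = k" using \<C> by (simp add: card_image)
    moreover have "unbounded g (off g F W) (h X)" if "X \<in> \<C>" for X
    proof -
      have "infinite (?R W (h X))" using h \<C>(1) that by auto
      then show ?thesis by (simp add: unbounded_def)
    qed
    moreover have "a = b" if "a \<in> h ` \<C>" "b \<in> h ` \<C>" "reach g (off g F W) a b" for a b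
      using that inj by blast
    ultimately show "ends k g F x" unfolding ends_def
      by (rule_tac exI[of _ W], rule_tac exI[of _ "h ` \<C>"]) (use W \<C>(2) h in \<open>auto simp: C_def\<close>)
  next
    assume "ends k g F x"
    then obtain W D where W: "finite W" "\<forall>w\<in>W. reach g F x w" and D: "finite D" "card D = k"
      "\<forall>a\<in>D. reach g F x a \<and> unbounded g (off g F W) a"
      "\<forall>a\<in>D. \<forall>b\<in>D. reach g (off g F W) a b \<longrightarrow> a = b"
      unfolding ends_def by (elim exE conjE) (rule that)
    have "D \<subseteq> C - W" using D(3) unbounded_off_notin by (fastforce simp: C_def)
    moreover have "inj_on (?R W) D"
    proof (rule inj_onI)
      fix a b assume ab: "a \<in> D" "b \<in> D" "?R W a = ?R W b"
      have "b \<in> ?R W b" by simp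
      then have "b \<in> ?R W a" by (simp only: ab(3))
      then show "a = b" using D(4) ab(1,2) by simp
    qed
    then have "card (?R W ` D) = k" using D by (simp add: card_image)
    moreover have "\<forall>X\<in>?R W ` D. infinite X" using D(3) by (auto simp: unbounded_def)
    moreover have "W \<subseteq> C" using W by (auto simp: C_def)
    ultimately show "\<exists>W \<C>. W \<subseteq> C \<and> finite W \<and> \<C> \<subseteq> {X \<in> ?R W ` (C - W). infinite X} \<and> finite \<C> \<and> card \<C> = k"
      using W D(1) by (rule_tac exI[of _ W], rule_tac exI[of _ "?R W ` D"]) auto
  qed
  finally show ?thesis by (simp add: C_def)
qed

section \<open>Exchanging edges in spanning trees\<close>

definition simple_path :: "('e \<Rightarrow> 'v set) \<Rightarrow> 'e set \<Rightarrow> 'v list \<Rightarrow> 'e list \<Rightarrow> bool" where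
  "simple_path g S vs es \<longleftrightarrow> length vs = Suc (length es) \<and> distinct vs \<and> distinct es \<and> set es \<subseteq> S \<and>
     (\<forall>i<length es. g (es ! i) = {vs ! i, vs ! Suc i})"

lemma reach_simple_path:
  assumes "reach g S a b"
  shows "\<exists>vs es. simple_path g S vs es \<and> vs ! 0 = a \<and> vs ! length es = b"
  using assms
proof (induction rule: reach_induct)
  case refl
  show ?case by (rule exI[of _ "[a]"], rule exI[of _ "[]"]) (simp add: simple_path_def)
next
  case (step x y e)
  then obtain vs es where p: "simple_path g S vs es" "vs ! 0 = a" "vs ! length es = x" by blast
  have len: "length vs = Suc (length es)" using p by (simp add: simple_path_def)
  show ?case
  proof (cases "y \<in> set vs")
    case True
    then obtain k where k: "k < length vs" "vs ! k = y" by (auto simp: in_set_conv_nth)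
    \<comment> \<open>Arriving at a visited vertex closes a detour, which is removed by truncating
      the path there.\<close>
    have "simple_path g S (take (Suc k) vs) (take k es)"
      using p(1) k(1) set_take_subset[of k es] unfolding simple_path_def by auto
    moreover have "length (take k es) = k" using k len by simp
    ultimately show ?thesis using p(2) k
      by (rule_tac exI[of _ "take (Suc k) vs"], rule_tac exI[of _ "take k es"]) simp
  next
    case False
    have "e \<notin> set es"
    proof
      assume "e \<in> set es"
      then obtain i where "i < length es" "es ! i = e" by (auto simp: in_set_conv_nth)
      then have "y \<in> {vs ! i, vs ! Suc i}" using p(1) step(3) by (auto simp: simple_path_def)
      then show False using False len \<open>i < length es\<close> by auto
    qed
    then have "simple_path g S (vs @ [y]) (es @ [e])"
      using p(1,3) False step(2,3) len unfolding simple_path_def by (auto simp: nth_append less_Suc_eq)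
    then show ?thesis using p(2) len
      by (rule_tac exI[of _ "vs @ [y]"], rule_tac exI[of _ "es @ [e]"]) (simp add: nth_append)
  qed
qed

text \<open>A cycle through \<open>e\<close> is \<open>e\<close> together with a simple path between
  its endpoints avoiding it, the empty path if \<open>e\<close> is a loop. So acyclicity becomes a
  statement about reachability: every edge is a bridge.\<close>

lemma cycle_free_iff:
  assumes t: "\<And>e. e \<in> t \<Longrightarrow> \<exists>a b. endpoints H e = {a, b}"
  shows "cycle_free (spanning_subgraph H t) \<longleftrightarrow>
    (\<forall>e\<in>t. \<forall>a b. endpoints H e = {a, b} \<longrightarrow> \<not> reach (endpoints H) (t - {e}) a b)"
    (is "_ \<longleftrightarrow> ?R")
proof
  assume cf: "cycle_free (spanning_subgraph H t)"
  show ?R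
  proof (intro ballI allI impI notI)
    fix e a b assume e: "e \<in> t" "endpoints H e = {a, b}" and "reach (endpoints H) (t - {e}) a b"
    then obtain vs es where p: "simple_path (endpoints H) (t - {e}) vs es" "vs ! 0 = a" "vs ! length es = b"
      using reach_simple_path by metis
    moreover have "Suc i mod Suc (length es) = Suc i" if "i < length es" for i using that by simp
    ultimately have "is_cycle (spanning_subgraph H t) vs (es @ [e])"
      using e unfolding is_cycle_def simple_path_def spanning_subgraph_def
      by (auto simp: nth_append less_Suc_eq insert_commute)
    then show False using cf by (auto simp: cycle_free_def)
  qed
next
  assume R: ?R
  show "cycle_free (spanning_subgraph H t)"
    unfolding cycle_free_def
  proof (intro notI, elim exE)
    fix vs es assume c: "is_cycle (spanning_subgraph H t) vs es"
    define n where "n = length es"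
    have n: "n > 0" and sub: "set es \<subseteq> t" and dist: "distinct es"
      and ep: "\<And>i. i < n \<Longrightarrow> endpoints H (es ! i) = {vs ! i, vs ! (Suc i mod n)}"
      using c by (auto simp: is_cycle_def n_def spanning_subgraph_def)
    \<comment> \<open>Go round the cycle from the far end of \<open>es ! 0\<close> without using
      that edge. The index \<open>1 mod n\<close> covers \<open>n = 1\<close>, where the edge is a
      loop at \<open>vs ! 0\<close>.\<close>
    have "reach (endpoints H) (t - {es ! 0}) (vs ! (1 mod n)) (vs ! (Suc i mod n))" if "i < n" for i
      using that
    proof (induction i)
      case (Suc i)
      then have "es ! Suc i \<in> t - {es ! 0}"
        using sub dist n by (auto simp: n_def nth_eq_iff_index_eq)
      then have "reach (endpoints H) (t - {es ! 0}) (vs ! Suc i) (vs ! (Suc (Suc i) mod n))"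
        using ep[OF Suc.prems] by (rule reach_edge)
      moreover have "Suc i mod n = Suc i" using Suc.prems by simp
      ultimately show ?case using Suc.IH Suc.prems by (auto intro: reach_trans)
    qed simp
    from this[of "n - 1"] have "reach (endpoints H) (t - {es ! 0}) (vs ! (1 mod n)) (vs ! 0)"
      using n by simp
    moreover have "es ! 0 \<in> t" using sub n by (auto simp: n_def)
    ultimately show False using R ep[of 0] n reach_sym[of "endpoints H" "t - {es ! 0}" "vs ! (1 mod n)" "vs ! 0"] by auto
  qed
qed

lemma spanning_trees_iff:
  assumes "multigraph H"
  shows "t \<in> spanning_trees H \<longleftrightarrow> t \<subseteq> edges H \<and> verts H \<noteq> {} \<and>
    (\<forall>a\<in>verts H. \<forall>b\<in>verts H. reach (endpoints H) t a b) \<and>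
    (\<forall>e\<in>t. \<forall>a b. endpoints H e = {a, b} \<longrightarrow> \<not> reach (endpoints H) (t - {e}) a b)"
proof (cases "t \<subseteq> edges H")
  case True
  then have "\<And>e. e \<in> t \<Longrightarrow> \<exists>a b. endpoints H e = {a, b}"
    using multigraph.endpoints_verts[OF assms] by blast
  from cycle_free_iff[of t H, OF this] True show ?thesis
    by (simp add: spanning_trees_def connected_graph_def linked_def adj_spanning)
      (simp add: spanning_subgraph_def)
qed (simp add: spanning_trees_def)

text \<open>Adding \<open>f\<close> closes a cycle through \<open>v\<close>, and \<open>d\<close> is
  its other edge at \<open>v\<close>: the last edge of the tree path from \<open>u\<close>. Taking
  \<open>d\<close> at \<open>v\<close> bounds the number of candidates by the degree of
  \<open>v\<close>.\<close>

lemma spanning_tree_exchange: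
  assumes H: "multigraph H" and t: "t \<in> spanning_trees H" and f: "f \<in> edges H" "endpoints H f = {u, v}"
    and uv: "u \<in> verts H" "v \<in> verts H" "u \<noteq> v" and "f \<notin> t"
  shows "\<exists>d\<in>t. v \<in> endpoints H d \<and> insert f (t - {d}) \<in> spanning_trees H"
proof -
  let ?r = "reach (endpoints H)"
  have t': "t \<subseteq> edges H" "\<And>a b. a \<in> verts H \<Longrightarrow> b \<in> verts H \<Longrightarrow> ?r t a b"
    "\<And>e a b. e \<in> t \<Longrightarrow> endpoints H e = {a, b} \<Longrightarrow> \<not> ?r (t - {e}) a b"
    using t by (auto simp: spanning_trees_iff[OF H])
  obtain w d where d: "?r (off (endpoints H) t {v}) u w" "d \<in> t" "endpoints H d = {w, v}"
    using reach_first_hit t'(2) uv by metis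
  let ?Q = "t - {d}" and ?T = "insert f (t - {d})"
  have uw: "?r ?Q u w" using d(1) by (rule reach_mono) (use d in \<open>auto simp: off_def\<close>)
  \<comment> \<open>\<open>w\<close> is still joined to \<open>u\<close>, while \<open>d\<close> was
    a bridge between \<open>w\<close> and \<open>v\<close>.\<close>
  have nuv: "\<not> ?r ?Q u v" using t'(3)[OF d(2,3)] reach_common[OF uw] by blast
  have wv: "?r ?T w v"
  proof -
    have "?r ?T w u" by (rule reach_sym, rule reach_mono[OF uw]) auto
    moreover have "?r ?T u v" using f by (intro reach_edge[of f]) auto
    ultimately show ?thesis by (rule reach_trans)
  qed
  have conn: "?r ?T a b" if "a \<in> verts H" "b \<in> verts H" for a b
  proof -
    have "?r (insert d ?Q) a b" using t'(2)[OF that] d(2) by (simp add: insert_absorb)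
    then have "?r ?Q a b \<or> ?r ?Q a w \<and> ?r ?Q v b \<or> ?r ?Q a v \<and> ?r ?Q w b"
      by (rule reach_insert_cases) (rule d(3))
    moreover have "?r ?T p q" if "?r ?Q p q" for p q using that by (rule reach_mono) auto
    ultimately show ?thesis using wv reach_sym[OF wv] reach_trans by metis
  qed
  have bridge: "\<not> ?r (?T - {e}) a b" if e: "e \<in> ?T" "endpoints H e = {a, b}" for e a b
  proof (cases "e = f")
    case True
    then have "?T - {e} = ?Q" using \<open>f \<notin> t\<close> by auto
    moreover have "a = u \<and> b = v \<or> a = v \<and> b = u" using e True f by (auto simp: doubleton_eq_iff)
    ultimately show ?thesis using nuv reach_sym by metis
  next
    case False
    then have eQ: "e \<in> ?Q" using e by auto
    show ?thesis
    proof
      assume "?r (?T - {e}) a b"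
      moreover have "?T - {e} = insert f (?Q - {e})" using False by auto
      \<comment> \<open>As \<open>e\<close> is a bridge of \<open>t\<close>, a detour around it
        would use \<open>f\<close>; combined with \<open>e\<close> it would join \<open>u\<close>
        and \<open>v\<close> in \<open>?Q\<close>.\<close>
      ultimately have c: "?r (?Q - {e}) a b \<or> ?r (?Q - {e}) a u \<and> ?r (?Q - {e}) v b \<or>
          ?r (?Q - {e}) a v \<and> ?r (?Q - {e}) u b"
        using reach_insert_cases[of "endpoints H" f "?Q - {e}" a b u v] f by simp
      have mono: "?r ?Q p q" if "?r (?Q - {e}) p q" for p q using that by (rule reach_mono) auto
      have "\<not> ?r (?Q - {e}) a b"
        using t'(3)[of e a b] e(2) eQ reach_mono[of "endpoints H" "?Q - {e}" a b "t - {e}"] by auto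
      moreover have "?r ?Q a b" using eQ e(2) by (rule reach_edge)
      ultimately consider "?r ?Q a u" "?r ?Q v b" | "?r ?Q a v" "?r ?Q u b" using c mono by blast
      then show False
      proof cases
        case 1
        then show False using nuv reach_trans[OF reach_common[OF 1(1) \<open>?r ?Q a b\<close>] reach_sym[OF 1(2)]] by simp
      next
        case 2
        then show False using nuv reach_trans[OF 2(2) reach_common[OF \<open>?r ?Q a b\<close> 2(1)]] by simp
      qed
    qed
  qed
  have "?T \<in> spanning_trees H"
    unfolding spanning_trees_iff[OF H]
  proof (intro conjI ballI allI impI)
    show "?T \<subseteq> edges H" using t'(1) f by auto
  qed (use conn bridge uv in auto)
  then show ?thesis using d by blast
qed

section \<open>Approximation by an algebra of sets\<close>

text \<open>One set must approximate \<open>E\<close> for all measures at once, since an inequality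
  between them is to be transferred. Complements keep the symmetric difference, and countable unions
  are truncated.\<close>

lemma algebra_approximation:
  fixes N :: "'i \<Rightarrow> 'a measure"
  assumes I: "finite I" and fm: "\<And>i. i \<in> I \<Longrightarrow> finite_measure (N i)"
    and sets: "\<And>i. i \<in> I \<Longrightarrow> sets (N i) = sigma_sets \<Omega> \<A>" and alg: "algebra \<Omega> \<A>"
    and E: "E \<in> sigma_sets \<Omega> \<A>" and "\<epsilon> > 0"
  shows "\<exists>B\<in>\<A>. \<forall>i\<in>I. measure (N i) (sym_diff E B) < \<epsilon>"
  using E \<open>\<epsilon> > 0\<close>
proof (induction arbitrary: \<epsilon> rule: sigma_sets.induct)
  interpret algebra \<Omega> \<A> by (rule alg)
  case (Basic a)
  then show ?case by (intro bexI[of _ a]) auto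
next
  interpret algebra \<Omega> \<A> by (rule alg)
  case Empty
  then show ?case by (intro bexI[of _ "{}"]) auto
next
  interpret algebra \<Omega> \<A> by (rule alg)
  case (Compl a)
  then obtain B where B: "B \<in> \<A>" "\<forall>i\<in>I. measure (N i) (sym_diff a B) < \<epsilon>" by blast
  have "a \<subseteq> \<Omega>" using Compl(1) sigma_sets_into_sp[OF space_closed] by blast
  moreover have "B \<subseteq> \<Omega>" using B(1) sets_into_space by blast
  ultimately have "sym_diff (\<Omega> - a) (\<Omega> - B) = sym_diff a B" by blast
  then show ?case using B by (intro bexI[of _ "\<Omega> - B"]) auto
next
  interpret algebra \<Omega> \<A> by (rule alg)
  case (Union a)
  let ?S = "sigma_sets \<Omega> \<A>"
  have S: "sigma_algebra \<Omega> ?S" by (rule sigma_algebra_sigma_sets[OF space_closed])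
  interpret S: sigma_algebra \<Omega> ?S by (rule S)
  have "\<forall>\<^sub>F n in sequentially. \<forall>i\<in>I. measure (N i) (\<Union>k. a k) - measure (N i) (\<Union>k<n. a k) < \<epsilon> / 2"
  proof (rule eventually_ball_finite[OF I], rule ballI)
    fix i assume i: "i \<in> I"
    interpret finite_measure "N i" by (rule fm[OF i])
    have "(\<lambda>n. measure (N i) (\<Union>k<n. a k)) \<longlonglongrightarrow> measure (N i) (\<Union>n. \<Union>k<n. a k)"
    proof (rule finite_Lim_measure_incseq)
      show "range (\<lambda>n. \<Union>k<n. a k) \<subseteq> sets (N i)" using Union(1) by (auto simp: sets[OF i])
    qed (auto simp: incseq_def intro: order_less_le_trans)
    moreover have "(\<Union>n. \<Union>k<n. a k) = (\<Union>k. a k)" by auto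
    ultimately have "(\<lambda>n. measure (N i) (\<Union>k<n. a k)) \<longlonglongrightarrow> measure (N i) (\<Union>k. a k)" by simp
    then have "\<forall>\<^sub>F n in sequentially. measure (N i) (\<Union>k<n. a k) > measure (N i) (\<Union>k. a k) - \<epsilon> / 2"
      by (rule order_tendstoD) (use Union.prems in simp)
    then show "\<forall>\<^sub>F n in sequentially. measure (N i) (\<Union>k. a k) - measure (N i) (\<Union>k<n. a k) < \<epsilon> / 2"
      by eventually_elim simp
  qed
  then obtain n where n: "\<forall>i\<in>I. measure (N i) (\<Union>k. a k) - measure (N i) (\<Union>k<n. a k) < \<epsilon> / 2"
    by (auto simp: eventually_sequentially)
  \<comment> \<open>Half of the allowance goes to the truncated tail, half to the \<open>n\<close>
    approximations. The summand \<open>1\<close> keeps the quotient meaningful for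
    \<open>n = 0\<close>.\<close>
  define \<delta> where "\<delta> = \<epsilon> / (2 * (real n + 1))"
  have \<delta>: "\<delta> > 0" "real n * \<delta> \<le> \<epsilon> / 2" using Union.prems by (auto simp: \<delta>_def field_simps)
  have "\<forall>k. \<exists>B. B \<in> \<A> \<and> (\<forall>i\<in>I. measure (N i) (sym_diff (a k) B) < \<delta>)"
    using Union(2) \<delta>(1) by blast
  from choice[OF this] obtain B where
    B: "\<forall>k. B k \<in> \<A> \<and> (\<forall>i\<in>I. measure (N i) (sym_diff (a k) (B k)) < \<delta>)" ..
  have BS: "B k \<in> ?S" for k using B by (auto intro: sigma_sets.Basic)
  show ?case
  proof (intro bexI[of _ "\<Union>k<n. B k"] ballI)
    show "(\<Union>k<n. B k) \<in> \<A>" using B by auto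
    fix i assume i: "i \<in> I"
    interpret finite_measure "N i" by (rule fm[OF i])
    note [simp] = sets[OF i]
    let ?R = "(\<Union>k. a k) - (\<Union>k<n. a k)"
    have a: "(\<Union>k. a k) \<in> ?S" "(\<Union>k<n. a k) \<in> ?S"
      and R: "?R \<in> ?S" and D: "(\<Union>k<n. sym_diff (a k) (B k)) \<in> ?S"
      using Union(1) BS by (auto intro!: S.countable_UN S.finite_UN S.Diff S.Un)
    have "measure (N i) (sym_diff (\<Union>k. a k) (\<Union>k<n. B k)) \<le>
        measure (N i) (?R \<union> (\<Union>k<n. sym_diff (a k) (B k)))"
      using R D by (intro finite_measure_mono) auto
    also have "\<dots> \<le> measure (N i) ?R + measure (N i) (\<Union>k<n. sym_diff (a k) (B k))"
      using R D by (intro measure_Un_le) auto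
    also have "measure (N i) ?R = measure (N i) (\<Union>k. a k) - measure (N i) (\<Union>k<n. a k)"
      using a by (intro finite_measure_Diff) auto
    also have "measure (N i) (\<Union>k<n. sym_diff (a k) (B k)) \<le> (\<Sum>k<n. measure (N i) (sym_diff (a k) (B k)))"
      using Union(1) BS by (intro finite_measure_subadditive_finite) auto
    also have "\<dots> \<le> (\<Sum>k<n. \<delta>)" using B i by (intro sum_mono) (simp add: less_imp_le)
    finally show "measure (N i) (sym_diff (\<Union>k. a k) (\<Union>k<n. B k)) < \<epsilon>"
      using n i \<delta>(2) by fastforce
  qed
qed

lemma (in finite_measure) measure_le_sym_diff:
  assumes "A \<in> sets M" "B \<in> sets M"
  shows "measure M A \<le> measure M B + measure M (sym_diff A B)"
proof -
  have "measure M A \<le> measure M (B \<union> sym_diff A B)"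
    using assms by (intro finite_measure_mono) auto
  also have "\<dots> \<le> measure M B + measure M (sym_diff A B)"
    using assms by (intro measure_Un_le) auto
  finally show ?thesis .
qed

text \<open>Both sides change little when \<open>E\<close> is replaced by an algebra set that is
  close to it for \<open>N\<close> and all \<open>L i\<close> simultaneously.\<close>

lemma measure_le_sum_extend:
  fixes N :: "'a measure" and L :: "'i \<Rightarrow> 'a measure" and r :: "'i \<Rightarrow> real"
  assumes I: "finite I" and r: "\<And>i. i \<in> I \<Longrightarrow> r i \<ge> 0"
    and N: "finite_measure N" "sets N = sigma_sets \<Omega> \<A>"
    and L: "\<And>i. i \<in> I \<Longrightarrow> finite_measure (L i)" "\<And>i. i \<in> I \<Longrightarrow> sets (L i) = sigma_sets \<Omega> \<A>"
    and alg: "algebra \<Omega> \<A>"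
    and le: "\<And>B. B \<in> \<A> \<Longrightarrow> measure N B \<le> (\<Sum>i\<in>I. r i * measure (L i) B)"
    and E: "E \<in> sigma_sets \<Omega> \<A>"
  shows "measure N E \<le> (\<Sum>i\<in>I. r i * measure (L i) E)"
proof (rule field_le_epsilon)
  fix e :: real assume "e > 0"
  define \<epsilon> where "\<epsilon> = e / (1 + sum r I)"
  have "sum r I \<ge> 0" using r by (rule sum_nonneg)
  then have pos: "1 + sum r I > 0" by linarith
  then have "\<epsilon> > 0" using \<open>e > 0\<close> by (simp add: \<epsilon>_def)
  \<comment> \<open>\<open>None\<close> indexes \<open>N\<close> and \<open>Some i\<close> indexes
    \<open>L i\<close>, so a single approximation serves both sides.\<close>
  let ?K = "case_option N L"
  have K: "finite_measure (?K i)" "sets (?K i) = sigma_sets \<Omega> \<A>" if "i \<in> insert None (Some ` I)" for i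
    using that N L by auto
  obtain B where B: "B \<in> \<A>" "\<forall>i\<in>insert None (Some ` I). measure (?K i) (sym_diff E B) < \<epsilon>"
    using algebra_approximation[of "insert None (Some ` I)" ?K, OF _ K alg E \<open>\<epsilon> > 0\<close>] I by blast
  have BS: "B \<in> sigma_sets \<Omega> \<A>" using B(1) by (rule sigma_sets.Basic)
  have LB: "measure (L i) B \<le> measure (L i) E + \<epsilon>" if "i \<in> I" for i
  proof -
    have "measure (L i) B \<le> measure (L i) E + measure (L i) (sym_diff B E)"
      using that E BS L by (intro finite_measure.measure_le_sym_diff) auto
    moreover have "sym_diff B E = sym_diff E B" by blast
    moreover have "measure (L i) (sym_diff E B) < \<epsilon>" using B(2) that by auto
    ultimately show ?thesis by simp
  qed
  have "measure N E \<le> measure N B + measure N (sym_diff E B)"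
    using E BS N by (intro finite_measure.measure_le_sym_diff) auto
  also have "\<dots> \<le> (\<Sum>i\<in>I. r i * measure (L i) B) + \<epsilon>"
    using B le by (intro add_mono) auto
  also have "\<dots> \<le> (\<Sum>i\<in>I. r i * (measure (L i) E + \<epsilon>)) + \<epsilon>"
    using LB r by (intro add_mono sum_mono mult_left_mono) auto
  also have "\<dots> = (\<Sum>i\<in>I. r i * measure (L i) E) + \<epsilon> * (1 + sum r I)"
    by (simp add: algebra_simps sum.distrib sum_distrib_left)
  also have "\<epsilon> * (1 + sum r I) = e" using pos by (simp add: \<epsilon>_def)
  finally show "measure N E \<le> (\<Sum>i\<in>I. r i * measure (L i) E) + e" .
qed

section \<open>Exchanging edges in uniform spanning trees and their limits\<close>

lemma finite_spanning_trees: "finite (edges H) \<Longrightarrow> finite (spanning_trees H)"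
  by (rule finite_subset[of _ "Pow (edges H)"]) (auto simp: spanning_trees_def)

lemma measure_ust:
  assumes "finite (edges H)" and c: "\<And>e. e \<in> edges H \<Longrightarrow> c e > 0" and "A \<subseteq> spanning_trees H"
  shows "measure (ust H c) A = (\<Sum>t\<in>A. (\<Prod>e\<in>t. c e) / (\<Sum>t'\<in>spanning_trees H. \<Prod>e\<in>t'. c e))"
proof -
  have "(\<Prod>e\<in>t. c e) \<ge> 0" if "t \<in> spanning_trees H" for t
    using that c by (intro prod_nonneg) (auto simp: spanning_trees_def intro: less_imp_le)
  then have "(\<Prod>e\<in>t. c e) / (\<Sum>t'\<in>spanning_trees H. \<Prod>e\<in>t'. c e) \<ge> 0" if "t \<in> spanning_trees H" for t
    using that by (intro divide_nonneg_nonneg sum_nonneg)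
  then show ?thesis unfolding ust_def
    using assms by (subst measure_point_measure_finite_if) (auto simp: finite_spanning_trees)
qed

lemma finite_measure_ust:
  assumes "finite (edges H)"
  shows "finite_measure (ust H c)"
proof
  show "emeasure (ust H c) (space (ust H c)) \<noteq> \<infinity>"
    using assms by (simp add: ust_def space_point_measure emeasure_point_measure_finite finite_spanning_trees)
qed

lemma space_ust [simp]: "space (ust H c) = spanning_trees H"
  and sets_ust [simp]: "sets (ust H c) = Pow (spanning_trees H)"
  by (simp_all add: ust_def space_point_measure sets_point_measure)

text \<open>Sort the trees without \<open>f\<close> by an admissible \<open>d\<close>. On each
  class, replacing \<open>d\<close> by \<open>f\<close> is injective and multiplies the weight by
  \<open>c f / c d\<close>. The classes may overlap, hence an upper bound.\<close>

lemma ust_exchange: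
  assumes H: "multigraph H" "finite (edges H)" and c: "\<And>e. e \<in> edges H \<Longrightarrow> c e > 0"
    and f: "f \<in> edges H" "endpoints H f = {u, v}" and uv: "u \<in> verts H" "v \<in> verts H" "u \<noteq> v"
  shows "\<P>(T in ust H c. f \<notin> T \<and> Q T) \<le> (\<Sum>d | d \<in> edges H \<and> v \<in> endpoints H d.
    c d / c f * \<P>(T in ust H c. f \<in> T \<and> d \<notin> T \<and> Q (insert d (T - {f}))))"
proof -
  interpret finite_measure "ust H c" by (rule finite_measure_ust[OF H(2)])
  let ?ST = "spanning_trees H" and ?D = "{d. d \<in> edges H \<and> v \<in> endpoints H d}"
  let ?Z = "\<Sum>t'\<in>?ST. \<Prod>e\<in>t'. c e"
  define A where "A = {T \<in> ?ST. f \<notin> T \<and> Q T}"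
  define Ad where "Ad d = {T \<in> A. d \<in> T \<and> insert f (T - {d}) \<in> ?ST}" for d
  define Bd where "Bd d = {T \<in> ?ST. f \<in> T \<and> d \<notin> T \<and> Q (insert d (T - {f}))}" for d
  have "A \<subseteq> (\<Union>d\<in>?D. Ad d)"
  proof
    fix T assume T: "T \<in> A"
    then have "T \<subseteq> edges H" by (auto simp: A_def spanning_trees_def)
    moreover obtain d where "d \<in> T" "v \<in> endpoints H d" "insert f (T - {d}) \<in> ?ST"
      using spanning_tree_exchange[OF H(1) _ f uv] T by (auto simp: A_def)
    ultimately show "T \<in> (\<Union>d\<in>?D. Ad d)" using T by (auto simp: Ad_def)
  qed
  then have "measure (ust H c) A \<le> measure (ust H c) (\<Union>d\<in>?D. Ad d)"
    by (intro finite_measure_mono) (auto simp: A_def Ad_def)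
  also have "\<dots> \<le> (\<Sum>d\<in>?D. measure (ust H c) (Ad d))"
    using H(2) by (intro finite_measure_subadditive_finite) (auto simp: A_def Ad_def)
  also have "\<dots> \<le> (\<Sum>d\<in>?D. c d / c f * measure (ust H c) (Bd d))"
  proof (rule sum_mono)
    fix d assume d: "d \<in> ?D"
    let ?h = "\<lambda>T. insert f (T - {d})"
    have inj: "inj_on ?h (Ad d)"
      by (rule inj_on_inverseI[of _ "\<lambda>T. insert d (T - {f})"]) (auto simp: Ad_def A_def)
    have weight: "(\<Prod>e\<in>T. c e) = c d / c f * (\<Prod>e\<in>?h T. c e)" if "T \<in> Ad d" for T
    proof -
      have T: "d \<in> T" "f \<notin> T" "finite T"
        using that H(2) finite_subset by (auto simp: Ad_def A_def spanning_trees_def)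
      then have "(\<Prod>e\<in>T. c e) = c d * (\<Prod>e\<in>T - {d}. c e)" by (simp add: prod.remove)
      moreover have "(\<Prod>e\<in>?h T. c e) = c f * (\<Prod>e\<in>T - {d}. c e)" using T by simp
      moreover have "c f \<noteq> 0" using c[OF f(1)] by simp
      ultimately show ?thesis by simp
    qed
    have sub: "?h ` Ad d \<subseteq> Bd d"
    proof (rule image_subsetI)
      fix T assume T: "T \<in> Ad d"
      then have "d \<noteq> f" "insert d (?h T - {f}) = T" by (auto simp: Ad_def A_def)
      then show "?h T \<in> Bd d" using T by (auto simp: Ad_def A_def Bd_def)
    qed
    have ST: "Ad d \<subseteq> ?ST" "?h ` Ad d \<subseteq> ?ST" by (auto simp: Ad_def A_def)
    have "measure (ust H c) (Ad d) = (\<Sum>T\<in>Ad d. c d / c f * ((\<Prod>e\<in>?h T. c e) / ?Z))"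
      using weight by (subst measure_ust[OF H(2) c ST(1)]) (auto intro!: sum.cong)
    also have "\<dots> = c d / c f * measure (ust H c) (?h ` Ad d)"
      by (subst measure_ust[OF H(2) c ST(2)]) (auto simp: sum.reindex[OF inj] sum_distrib_left)
    also have "\<dots> \<le> c d / c f * measure (ust H c) (Bd d)"
      using c d f sub
      by (intro mult_left_mono finite_measure_mono divide_nonneg_nonneg) (auto simp: Bd_def intro: less_imp_le)
    finally show "measure (ust H c) (Ad d) \<le> c d / c f * measure (ust H c) (Bd d)" .
  qed
  finally show ?thesis by (simp add: A_def Bd_def)
qed

section \<open>Wired quotients and the limit measure\<close>

lemma multigraph_wired:
  assumes "multigraph G"
  shows "multigraph (wired G H)"
proof
  fix e assume "e \<in> edges (wired G H)"
  then have "e \<in> edges G" by (simp add: wired_def)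
  then obtain u v where "endpoints G e = {u, v}"
    using multigraph.endpoints_verts[OF assms] by blast
  let ?h = "\<lambda>x. if x \<in> verts H then Some x else None"
  have "endpoints (wired G H) e = {?h u, ?h v}" "?h u \<in> verts (wired G H)" "?h v \<in> verts (wired G H)"
    using \<open>endpoints G e = {u, v}\<close> by (auto simp: wired_def)
  then show "\<exists>u\<in>verts (wired G H). \<exists>v\<in>verts (wired G H). endpoints (wired G H) e = {u, v}"
    by blast
qed

lemma (in network) finite_edges_wired:
  assumes "finite (verts H)" "verts H \<subseteq> verts G"
  shows "finite (edges (wired G H))"
proof (rule finite_subset)
  show "edges (wired G H) \<subseteq> (\<Union>x\<in>verts H. {e \<in> edges G. x \<in> endpoints G e})"
    by (auto simp: wired_def)
  show "finite (\<Union>x\<in>verts H. {e \<in> edges G. x \<in> endpoints G e})"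
    using assms locally_finite by blast
qed

text \<open>Makes the range of summation in the exchange bound independent of the stage of the
  exhaustion.\<close>

lemma wired_incident:
  assumes "v \<in> verts H"
  shows "{d. d \<in> edges (wired G H) \<and> Some v \<in> endpoints (wired G H) d} =
    {d. d \<in> edges G \<and> v \<in> endpoints G d}"
  using assms by (auto simp: wired_def image_iff)

locale wired_limit = network G c for G :: "('v, 'e) mgraph" and c :: "'e \<Rightarrow> real" +
  fixes M :: "'e set measure" and X :: "nat \<Rightarrow> ('v, 'e) mgraph"
  assumes prob: "prob_space M" and sets_edge_configs: "sets M = sets (edge_configs G)"
    and exh: "exhaustion G X"
    and lim: "\<And>S. finite S \<Longrightarrow> S \<subseteq> edges G \<Longrightarrow>
      (\<lambda>n. \<P>(T in ust (wired G (X n)) c. S \<subseteq> T)) \<longlonglongrightarrow> \<P>(F in M. S \<subseteq> F)"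
begin

sublocale M: prob_space M by (rule prob)

lemma edge_generators: "{{F \<in> Pow (edges G). e \<in> F} | e. e \<in> edges G} \<subseteq> Pow (Pow (edges G))"
  by blast

lemma sets_M: "sets M = sigma_sets (Pow (edges G)) {{F \<in> Pow (edges G). e \<in> F} | e. e \<in> edges G}"
  unfolding sets_edge_configs edge_configs_def by (rule sets_measure_of[OF edge_generators])

lemma space_M: "space M = Pow (edges G)"
  using sets_eq_imp_space_eq[OF sets_edge_configs] space_measure_of[OF edge_generators]
  by (simp add: edge_configs_def)

lemma mem_measurable: "{F \<in> space M. e \<in> F} \<in> sets M"
proof (cases "e \<in> edges G")
  case True
  then show ?thesis unfolding sets_M space_M by (intro sigma_sets.Basic) blast
next
  case False
  then have "{F \<in> space M. e \<in> F} = {}" by (auto simp: space_M)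
  then show ?thesis by (simp only: sets.empty_sets)
qed

lemma subset_measurable:
  assumes "finite S"
  shows "{F \<in> space M. S \<subseteq> F} \<in> sets M"
  using sets.sets_Collect_finite_All[OF mem_measurable assms] by (simp add: subset_eq)

lemma X_verts: "finite (verts (X n))" "verts (X n) \<subseteq> verts G"
  using exh by (auto simp: exhaustion_def subgraph_def)

lemma X_eventually: "v \<in> verts G \<Longrightarrow> \<forall>\<^sub>F n in sequentially. v \<in> verts (X n)"
proof -
  assume "v \<in> verts G"
  moreover have "verts G = (\<Union>n. verts (X n))" using exh by (simp add: exhaustion_def)
  ultimately obtain m where m: "v \<in> verts (X m)" by auto
  have "verts (X n) \<subseteq> verts (X (Suc n))" for n using exh by (auto simp: exhaustion_def subgraph_def)
  then have "verts (X m) \<subseteq> verts (X n)" if "n \<ge> m" for n using lift_Suc_mono_le[of "\<lambda>n. verts (X n)"] that by blast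
  then show ?thesis using m by (auto simp: eventually_sequentially intro!: exI[of _ m])
qed

lemma countable_verts: "countable (verts G)"
proof -
  have "verts G = (\<Union>n. verts (X n))" using exh by (auto simp: exhaustion_def)
  then show ?thesis using X_verts(1) by (simp add: countable_finite)
qed

lemma countable_edges: "countable (edges G)"
proof -
  have "edges G = (\<Union>n. edges (X n))" using exh by (auto simp: exhaustion_def)
  moreover have "finite (edges (X n))" for n using exh by (auto simp: exhaustion_def)
  ultimately show ?thesis by (simp add: countable_finite)
qed

section \<open>Events depending on finitely many edges, and their limits\<close>

abbreviation U where "U n \<equiv> ust (wired G (X n)) c"

lemma finite_measure_U: "finite_measure (U n)"
  by (intro finite_measure_ust finite_edges_wired X_verts)

text \<open>Inclusion-exclusion on one edge: the part without \<open>e\<close> is everything minus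
  the part with \<open>e\<close>, so only presence of edges is ever demanded. A general
  \<open>N\<close> covers both the limit and the finite trees.\<close>

lemma split_edge:
  assumes N: "finite_measure N"
    and m: "{F \<in> space N. insert e A \<subseteq> F \<and> P F} \<in> sets N" "{F \<in> space N. A \<subseteq> F \<and> R F} \<in> sets N"
      "{F \<in> space N. insert e A \<subseteq> F \<and> R F} \<in> sets N"
    and Q: "\<And>F. Q F \<longleftrightarrow> (if e \<in> F then P F else R F)"
  shows "{F \<in> space N. A \<subseteq> F \<and> Q F} \<in> sets N"
    and "\<P>(F in N. A \<subseteq> F \<and> Q F) = \<P>(F in N. insert e A \<subseteq> F \<and> P F) +
      (\<P>(F in N. A \<subseteq> F \<and> R F) - \<P>(F in N. insert e A \<subseteq> F \<and> R F))"
proof -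
  let ?P = "{F \<in> space N. insert e A \<subseteq> F \<and> P F}" and ?R = "{F \<in> space N. A \<subseteq> F \<and> R F}"
    and ?R' = "{F \<in> space N. insert e A \<subseteq> F \<and> R F}"
  have eq: "{F \<in> space N. A \<subseteq> F \<and> Q F} = ?P \<union> (?R - ?R')" unfolding Q by auto
  show "{F \<in> space N. A \<subseteq> F \<and> Q F} \<in> sets N" unfolding eq using m by auto
  have "measure N (?P \<union> (?R - ?R')) = measure N ?P + measure N (?R - ?R')"
    using m by (intro finite_measure.finite_measure_Union[OF N]) auto
  also have "measure N (?R - ?R') = measure N ?R - measure N ?R'"
    using m by (intro finite_measure.finite_measure_Diff[OF N]) auto
  finally show "\<P>(F in N. A \<subseteq> F \<and> Q F) = \<P>(F in N. insert e A \<subseteq> F \<and> P F) +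
      (\<P>(F in N. A \<subseteq> F \<and> R F) - \<P>(F in N. insert e A \<subseteq> F \<and> R F))" unfolding eq .
qed

text \<open>Convergence is given for the events \<open>S \<subseteq> F\<close> only. Induction on
  \<open>K\<close> decides one edge at a time, moving it into \<open>A\<close> where its presence is
  demanded; hence \<open>Q\<close> and \<open>A\<close> vary.\<close>

lemma local_event:
  assumes "finite K" "K \<subseteq> edges G" "\<And>F. Q F \<longleftrightarrow> Q (F \<inter> K)" "finite A" "A \<subseteq> edges G"
  shows "{F \<in> space M. A \<subseteq> F \<and> Q F} \<in> sets M \<and>
    (\<lambda>n. \<P>(T in U n. A \<subseteq> T \<and> Q T)) \<longlonglongrightarrow> \<P>(F in M. A \<subseteq> F \<and> Q F)"
  using assms
proof (induction K arbitrary: Q A rule: finite_induct)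
  case empty
  then have "(\<forall>F. Q F) \<or> (\<forall>F. \<not> Q F)" by auto
  then show ?case
  proof
    assume "\<forall>F. Q F"
    then show ?thesis using lim subset_measurable empty.prems by simp
  qed simp
next
  case (insert e K)
  let ?P = "\<lambda>F. Q (insert e F)" and ?R = "\<lambda>F. Q (F - {e})"
  have P: "?P F \<longleftrightarrow> ?P (F \<inter> K)" for F
  proof -
    have "insert e (F \<inter> K) = insert e F \<inter> insert e K" by blast
    then show ?thesis using insert.prems(2)[of "insert e F"] by simp
  qed
  have R: "?R F \<longleftrightarrow> ?R (F \<inter> K)" for F
  proof -
    have "F \<inter> K - {e} = (F - {e}) \<inter> insert e K" using insert.hyps(2) by blast
    then show ?thesis using insert.prems(2)[of "F - {e}"] by simp
  qed
  have Q: "Q F \<longleftrightarrow> (if e \<in> F then ?P F else ?R F)" for F by (simp add: insert_absorb)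
  have K: "K \<subseteq> edges G" and eA: "finite (insert e A)" "insert e A \<subseteq> edges G"
    using insert.prems by auto
  note P' = insert.IH[of ?P "insert e A", OF K P eA] and R' = insert.IH[of ?R A, OF K R insert.prems(3,4)]
    and S' = insert.IH[of ?R "insert e A", OF K R eA]
  note M = split_edge[OF M.finite_measure_axioms P'[THEN conjunct1] R'[THEN conjunct1] S'[THEN conjunct1] Q]
  have U: "\<P>(F in U n. A \<subseteq> F \<and> Q F) = \<P>(F in U n. insert e A \<subseteq> F \<and> ?P F) +
      (\<P>(F in U n. A \<subseteq> F \<and> ?R F) - \<P>(F in U n. insert e A \<subseteq> F \<and> ?R F))" for n
    by (rule split_edge(2)[OF finite_measure_U _ _ _ Q]) auto
  show ?case unfolding M(2) U using M(1) P' R' S' by (auto intro!: tendsto_intros)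
qed

text \<open>The cylinder sets: membership is decided in a finite window \<open>K\<close>. They form
  an algebra generating the sigma-algebra of \<open>M\<close>.\<close>

definition local_events :: "'e set set set" where
  "local_events = {E \<in> Pow (Pow (edges G)). \<exists>K. finite K \<and> K \<subseteq> edges G \<and>
     (\<forall>F \<in> Pow (edges G). F \<in> E \<longleftrightarrow> F \<inter> K \<in> E)}"

lemma algebra_local_events: "algebra (Pow (edges G)) local_events"
  unfolding algebra_iff_Un
proof (intro conjI ballI)
  show "local_events \<subseteq> Pow (Pow (edges G))" by (auto simp: local_events_def)
  show "{} \<in> local_events" by (auto simp: local_events_def)
next
  fix a assume "a \<in> local_events"
  then obtain K where "a \<subseteq> Pow (edges G)" "finite K" "K \<subseteq> edges G" "\<forall>F \<in> Pow (edges G). F \<in> a \<longleftrightarrow> F \<inter> K \<in> a"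
    by (auto simp: local_events_def)
  then show "Pow (edges G) - a \<in> local_events"
    unfolding local_events_def by (intro CollectI conjI exI[of _ K]) auto
next
  fix a b assume "a \<in> local_events" "b \<in> local_events"
  then obtain K L where K: "a \<subseteq> Pow (edges G)" "finite K" "K \<subseteq> edges G" "\<forall>F \<in> Pow (edges G). F \<in> a \<longleftrightarrow> F \<inter> K \<in> a"
    and L: "b \<subseteq> Pow (edges G)" "finite L" "L \<subseteq> edges G" "\<forall>F \<in> Pow (edges G). F \<in> b \<longleftrightarrow> F \<inter> L \<in> b"
    by (auto simp: local_events_def)
  have "F \<in> a \<union> b \<longleftrightarrow> F \<inter> (K \<union> L) \<in> a \<union> b" if F: "F \<in> Pow (edges G)" for F
  proof -
    have F': "F \<inter> (K \<union> L) \<in> Pow (edges G)" using F by blast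
    have "F \<inter> (K \<union> L) \<inter> K = F \<inter> K" "F \<inter> (K \<union> L) \<inter> L = F \<inter> L" by blast+
    then show ?thesis using K(4) L(4) F F' by (metis Un_iff)
  qed
  then show "a \<union> b \<in> local_events"
    unfolding local_events_def using K L by (intro CollectI conjI exI[of _ "K \<union> L"]) auto
qed

lemma local_events_eq:
  assumes "B \<in> local_events"
  shows "\<exists>K. finite K \<and> K \<subseteq> edges G \<and> (\<forall>F. F \<subseteq> edges G \<longrightarrow> (F \<in> B \<longleftrightarrow> F \<inter> K \<in> B))"
  using assms by (auto simp: local_events_def)

lemma sets_M_local: "sets M = sigma_sets (Pow (edges G)) local_events"
proof
  have "{F \<in> Pow (edges G). e \<in> F} \<in> local_events" if "e \<in> edges G" for e
    unfolding local_events_def using that by (intro CollectI conjI exI[of _ "{e}"]) auto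
  then show "sets M \<subseteq> sigma_sets (Pow (edges G)) local_events"
    unfolding sets_M by (intro sigma_sets_mono') blast
  have "B \<in> sets M" if B: "B \<in> local_events" for B
  proof -
    obtain K where K: "finite K" "K \<subseteq> edges G" "\<forall>F. F \<subseteq> edges G \<longrightarrow> (F \<in> B \<longleftrightarrow> F \<inter> K \<in> B)"
      using local_events_eq[OF B] by (elim exE conjE) (rule that)
    have "{F \<in> space M. {} \<subseteq> F \<and> F \<inter> K \<in> B} \<in> sets M"
      using local_event[of K "\<lambda>F. F \<inter> K \<in> B" "{}"] K by (simp add: Int_assoc)
    moreover have "{F \<in> space M. {} \<subseteq> F \<and> F \<inter> K \<in> B} = B"
      using K(3) B by (auto simp: space_M local_events_def)
    ultimately show ?thesis by simp
  qed
  then show "sigma_sets (Pow (edges G)) local_events \<subseteq> sets M"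
    using sets.sigma_sets_subset[of local_events M] by (auto simp: space_M)
qed

text \<open>The bound for finite trees passes to the limit, since each probability in it concerns
  finitely many edges.\<close>

lemma local_exchange:
  assumes f: "f \<in> edges G" "endpoints G f = {u, v}" "u \<noteq> v" and B: "B \<in> local_events"
  shows "measure M ({F \<in> space M. f \<notin> F} \<inter> B) \<le> (\<Sum>d | d \<in> edges G \<and> v \<in> endpoints G d.
    c d / c f * \<P>(F in M. f \<in> F \<and> d \<notin> F \<and> insert d (F - {f}) \<in> B))"
proof -
  let ?D = "{d. d \<in> edges G \<and> v \<in> endpoints G d}"
  obtain K where K: "finite K" "K \<subseteq> edges G" "\<forall>F. F \<subseteq> edges G \<longrightarrow> (F \<in> B \<longleftrightarrow> F \<inter> K \<in> B)"
    using local_events_eq[OF B] by (elim exE conjE) (rule that)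
  have uv: "u \<in> verts G" "v \<in> verts G"
    using endpoints_verts[OF f(1)] f(2) by (auto simp: doubleton_eq_iff)
  let ?Q = "\<lambda>F. F \<inter> K \<in> B"
  have l: "(\<lambda>n. \<P>(T in U n. f \<notin> T \<and> ?Q T)) \<longlonglongrightarrow> \<P>(F in M. f \<notin> F \<and> ?Q F)"
  proof -
    have "F \<inter> insert f K \<inter> K = F \<inter> K" for F by blast
    then show ?thesis
      using local_event[of "insert f K" "\<lambda>F. f \<notin> F \<and> ?Q F" "{}"] K f by simp
  qed
  have r: "(\<lambda>n. \<P>(T in U n. f \<in> T \<and> d \<notin> T \<and> ?Q (insert d (T - {f})))) \<longlonglongrightarrow>
      \<P>(F in M. f \<in> F \<and> d \<notin> F \<and> ?Q (insert d (F - {f})))" if "d \<in> ?D" for d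
  proof -
    have "insert d (F \<inter> insert f (insert d K) - {f}) \<inter> K = insert d (F - {f}) \<inter> K" for F by blast
    then show ?thesis
      using local_event[of "insert f (insert d K)" "\<lambda>F. f \<in> F \<and> d \<notin> F \<and> ?Q (insert d (F - {f}))" "{}"] K f that
      by simp
  qed
  have "\<P>(F in M. f \<notin> F \<and> ?Q F) \<le>
      (\<Sum>d\<in>?D. c d / c f * \<P>(F in M. f \<in> F \<and> d \<notin> F \<and> ?Q (insert d (F - {f}))))"
  proof (rule tendsto_le[OF _ _ l])
    show "(\<lambda>n. \<Sum>d\<in>?D. c d / c f * \<P>(T in U n. f \<in> T \<and> d \<notin> T \<and> ?Q (insert d (T - {f})))) \<longlonglongrightarrow>
      (\<Sum>d\<in>?D. c d / c f * \<P>(F in M. f \<in> F \<and> d \<notin> F \<and> ?Q (insert d (F - {f}))))"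
      using r by (intro tendsto_sum tendsto_mult_left)
    show "\<forall>\<^sub>F n in sequentially. \<P>(T in U n. f \<notin> T \<and> ?Q T) \<le>
      (\<Sum>d\<in>?D. c d / c f * \<P>(T in U n. f \<in> T \<and> d \<notin> T \<and> ?Q (insert d (T - {f}))))"
      \<comment> \<open>Once \<open>u\<close> and \<open>v\<close> belong to \<open>X n\<close>, the
        wiring keeps the endpoints of \<open>f\<close> distinct and away from the boundary
        vertex.\<close>
      using X_eventually[OF uv(1)] X_eventually[OF uv(2)]
    proof eventually_elim
      case (elim n)
      have "\<P>(T in U n. f \<notin> T \<and> ?Q T) \<le> (\<Sum>d | d \<in> edges (wired G (X n)) \<and> Some v \<in> endpoints (wired G (X n)) d.
          c d / c f * \<P>(T in U n. f \<in> T \<and> d \<notin> T \<and> ?Q (insert d (T - {f}))))"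
      proof (rule ust_exchange)
        show "multigraph (wired G (X n))" by (rule multigraph_wired[OF multigraph_axioms])
        show "finite (edges (wired G (X n)))" by (intro finite_edges_wired X_verts)
        show "f \<in> edges (wired G (X n))" "endpoints (wired G (X n)) f = {Some u, Some v}"
          using f elim by (auto simp: wired_def)
      qed (use f elim conductance_pos in \<open>auto simp: wired_def\<close>)
      then show ?case unfolding wired_incident[OF elim(2)] .
    qed
  qed simp
  moreover have "{F \<in> space M. f \<notin> F \<and> ?Q F} = {F \<in> space M. f \<notin> F} \<inter> B"
    using K(3) B by (auto simp: space_M local_events_def)
  moreover have "{F \<in> space M. f \<in> F \<and> d \<notin> F \<and> ?Q (insert d (F - {f}))} =
      {F \<in> space M. f \<in> F \<and> d \<notin> F \<and> insert d (F - {f}) \<in> B}" if "d \<in> ?D" for d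
  proof -
    have "insert d (F - {f}) \<in> B \<longleftrightarrow> ?Q (insert d (F - {f}))" if "F \<in> space M" for F
      using that \<open>d \<in> ?D\<close> K(3)[rule_format, of "insert d (F - {f})"] by (auto simp: space_M)
    then show ?thesis by blast
  qed
  ultimately show ?thesis by simp
qed

lemma swap_measurable:
  assumes "d \<in> edges G"
  shows "(\<lambda>F. insert d (F - {f})) \<in> M \<rightarrow>\<^sub>M M"
proof (rule measurable_sigma_sets[OF sets_M edge_generators])
  show "(\<lambda>F. insert d (F - {f})) \<in> space M \<rightarrow> Pow (edges G)" using assms by (auto simp: space_M)
  fix Y assume "Y \<in> {{F \<in> Pow (edges G). e \<in> F} | e. e \<in> edges G}"
  then obtain e where Y: "Y = {F \<in> Pow (edges G). e \<in> F}" by blast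
  have "(\<lambda>F. insert d (F - {f})) -` Y \<inter> space M =
      (if e = d then space M else if e = f then {} else {F \<in> space M. e \<in> F})"
    using assms by (auto simp: Y space_M)
  then show "(\<lambda>F. insert d (F - {f})) -` Y \<inter> space M \<in> sets M" using mem_measurable by simp
qed

text \<open>The exchange bound compares finite measures, so it extends from cylinder sets to the
  arbitrary event \<open>E\<close>. A positive left side then forces a positive summand.\<close>

lemma edge_exchange:
  assumes f: "f \<in> edges G" "endpoints G f = {u, v}" "u \<noteq> v" and E: "E \<in> sets M"
    and pos: "measure M E > 0" and avoid: "\<And>F. F \<in> E \<Longrightarrow> f \<notin> F"
  obtains d where "d \<in> edges G" "v \<in> endpoints G d"
    "\<P>(F in M. f \<in> F \<and> d \<notin> F \<and> insert d (F - {f}) \<in> E) > 0"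
proof -
  let ?D = "{d. d \<in> edges G \<and> v \<in> endpoints G d}"
  define C where "C d = {F \<in> space M. f \<in> F \<and> d \<notin> F}" for d
  \<comment> \<open>As a function of the event, the probability belonging to \<open>d\<close> in the
    exchange bound is a measure: the image of a restriction of \<open>M\<close> under undoing the
    exchange.\<close>
  define L where "L d = distr (density M (indicator (C d))) M (\<lambda>F. insert d (F - {f}))" for d
  have notmem: "{F \<in> space M. e \<notin> F} \<in> sets M" for e
    using sets.sets_Collect_neg[OF mem_measurable] .
  have C: "C d \<in> sets M" for d
    unfolding C_def by (intro sets.sets_Collect_conj mem_measurable notmem)
  have swap: "(\<lambda>F. insert d (F - {f})) \<in> density M (indicator (C d)) \<rightarrow>\<^sub>M M" if "d \<in> ?D" for d
    using swap_measurable[of d f] that by simp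
  have L: "measure (L d) B = \<P>(F in M. f \<in> F \<and> d \<notin> F \<and> insert d (F - {f}) \<in> B)"
    if "d \<in> ?D" "B \<in> sets M" for d B
  proof -
    have "measure (L d) B = measure M (C d \<inter> ((\<lambda>F. insert d (F - {f})) -` B \<inter> space M))"
      unfolding L_def using swap[OF that(1)] that C measurable_sets[OF swap_measurable[of d f] that(2)]
      by (simp add: measure_distr measure_restricted)
    also have "C d \<inter> ((\<lambda>F. insert d (F - {f})) -` B \<inter> space M) =
        {F \<in> space M. f \<in> F \<and> d \<notin> F \<and> insert d (F - {f}) \<in> B}" by (auto simp: C_def)
    finally show ?thesis .
  qed
  have "measure (density M (indicator {F \<in> space M. f \<notin> F})) E \<le> (\<Sum>d\<in>?D. c d / c f * measure (L d) E)"
  proof (rule measure_le_sum_extend[where \<Omega> = "Pow (edges G)" and \<A> = local_events])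
    have "v \<in> verts G" using endpoints_verts[OF f(1)] f(2) by (auto simp: doubleton_eq_iff)
    then show "finite ?D" by (rule locally_finite)
    show "0 \<le> c d / c f" if "d \<in> ?D" for d
      using that f(1) conductance_pos by (intro divide_nonneg_nonneg) (auto intro: less_imp_le)
    show "finite_measure (density M (indicator {F \<in> space M. f \<notin> F}))"
      by (intro M.finite_measure_restricted notmem)
    show "finite_measure (L d)" if "d \<in> ?D" for d
      unfolding L_def by (intro finite_measure.finite_measure_distr M.finite_measure_restricted C swap that)
    show "E \<in> sigma_sets (Pow (edges G)) local_events" using E by (simp add: sets_M_local)
    show "algebra (Pow (edges G)) local_events" by (rule algebra_local_events)
    fix B assume B: "B \<in> local_events"
    then have "B \<in> sets M" unfolding sets_M_local by (rule sigma_sets.Basic)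
    then show "measure (density M (indicator {F \<in> space M. f \<notin> F})) B \<le>
        (\<Sum>d\<in>?D. c d / c f * measure (L d) B)"
      using local_exchange[OF f B] L notmem by (simp add: measure_restricted)
  qed (simp_all add: sets_M_local L_def)
  moreover have "measure (density M (indicator {F \<in> space M. f \<notin> F})) E = measure M E"
  proof -
    have "{F \<in> space M. f \<notin> F} \<inter> E = E" using E avoid sets.sets_into_space by blast
    then show ?thesis using E notmem by (simp add: measure_restricted)
  qed
  ultimately have "(\<Sum>d\<in>?D. c d / c f * measure (L d) E) > 0" using pos by simp
  then obtain d where "d \<in> ?D" "c d / c f * measure (L d) E \<noteq> 0"
    by (metis (no_types, lifting) less_irrefl sum.neutral)
  then show ?thesis using that[of d] L[OF _ E] measure_nonneg[of M] by (simp add: order_less_le)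
qed

end

section \<open>Joining two components\<close>

lemma pred_countable_bex:
  assumes "countable I" "\<And>i. i \<in> I \<Longrightarrow> Measurable.pred N (\<lambda>x. P x i)"
  shows "Measurable.pred N (\<lambda>x. \<exists>i\<in>I. P x i)"
proof -
  have "{x \<in> space N. \<exists>i\<in>I. P x i} = (\<Union>i\<in>I. {x \<in> space N. P x i})" by blast
  then show ?thesis using assms unfolding pred_def by (auto intro!: sets.countable_UN')
qed

lemma pred_countable_ball:
  assumes "countable I" "\<And>i. i \<in> I \<Longrightarrow> Measurable.pred N (\<lambda>x. P x i)"
  shows "Measurable.pred N (\<lambda>x. \<forall>i\<in>I. P x i)"
proof -
  have "Measurable.pred N (\<lambda>x. \<not> (\<exists>i\<in>I. \<not> P x i))"
    using assms by (intro pred_intros_logic(2) pred_countable_bex)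
  then show ?thesis by simp
qed

context wired_limit
begin

text \<open>A finite edge set witnesses reachability, and countably many edges have countably many
  finite subsets. The fixed \<open>T\<close> accommodates deletions of an edge or of a vertex
  set.\<close>

lemma pred_reach: "Measurable.pred M (\<lambda>F. reach (endpoints G) (F \<inter> T) a b)"
proof -
  let ?K = "{K \<in> {K. finite K \<and> K \<subseteq> edges G}. K \<subseteq> T \<and> reach (endpoints G) K a b}"
  have "{F \<in> space M. reach (endpoints G) (F \<inter> T) a b} = (\<Union>K\<in>?K. {F \<in> space M. K \<subseteq> F})"
  proof (intro equalityI subsetI)
    fix F assume F: "F \<in> {F \<in> space M. reach (endpoints G) (F \<inter> T) a b}"
    then obtain K where "finite K" "K \<subseteq> F \<inter> T" "reach (endpoints G) K a b"
      using reach_finite_subset[of "endpoints G" "F \<inter> T" a b] by auto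
    then show "F \<in> (\<Union>K\<in>?K. {F \<in> space M. K \<subseteq> F})" using F by (auto simp: space_M)
  next
    fix F assume "F \<in> (\<Union>K\<in>?K. {F \<in> space M. K \<subseteq> F})"
    then show "F \<in> {F \<in> space M. reach (endpoints G) (F \<inter> T) a b}"
      by (auto intro: reach_mono)
  qed
  moreover have "countable ?K"
    by (rule countable_subset[OF _ countable_Collect_finite_subset[OF countable_edges]]) auto
  ultimately show ?thesis
    unfolding pred_def by (auto intro!: sets.countable_UN' subset_measurable)
qed

lemma countable_finite_verts: "countable {K. finite K \<and> K \<subseteq> verts G}"
  by (rule countable_Collect_finite_subset[OF countable_verts])

text \<open>A component is infinite iff it leaves each of the countably many finite vertex
  sets.\<close>

lemma pred_unbounded:
  assumes a: "a \<in> verts G"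
  shows "Measurable.pred M (\<lambda>F. unbounded (endpoints G) (F \<inter> T) a)"
proof -
  have "unbounded (endpoints G) (F \<inter> T) a \<longleftrightarrow>
      (\<forall>K\<in>{K. finite K \<and> K \<subseteq> verts G}. \<exists>b\<in>verts G - K. reach (endpoints G) (F \<inter> T) a b)"
    if F: "F \<in> space M" for F
  proof -
    let ?C = "{b. reach (endpoints G) (F \<inter> T) a b}"
    have sub: "?C \<subseteq> verts G" using reach_verts[of "F \<inter> T" a] a F by (auto simp: space_M)
    show ?thesis
    proof
      assume u: "unbounded (endpoints G) (F \<inter> T) a"
      have "\<not> ?C \<subseteq> K" if "finite K" for K
        using u that finite_subset by (auto simp: unbounded_def)
      then show "\<forall>K\<in>{K. finite K \<and> K \<subseteq> verts G}. \<exists>b\<in>verts G - K. reach (endpoints G) (F \<inter> T) a b"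
        using sub by blast
    next
      assume "\<forall>K\<in>{K. finite K \<and> K \<subseteq> verts G}. \<exists>b\<in>verts G - K. reach (endpoints G) (F \<inter> T) a b"
      then show "unbounded (endpoints G) (F \<inter> T) a" using sub unfolding unbounded_def by blast
    qed
  qed
  then have "Measurable.pred M (\<lambda>F. unbounded (endpoints G) (F \<inter> T) a) \<longleftrightarrow>
      Measurable.pred M (\<lambda>F. \<forall>K\<in>{K. finite K \<and> K \<subseteq> verts G}. \<exists>b\<in>verts G - K. reach (endpoints G) (F \<inter> T) a b)"
    by (rule measurable_cong)
  moreover have "\<dots>"
    by (intro pred_countable_ball pred_countable_bex pred_reach countable_finite_verts countable_Diff countable_verts)
  ultimately show ?thesis by blast
qed

lemma pred_core:
  assumes "y \<in> verts G"
  shows "Measurable.pred M (\<lambda>F. core (endpoints G) F y)"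
proof -
  have "core (endpoints G) F y \<longleftrightarrow> unbounded (endpoints G) (F \<inter> UNIV) y \<and>
      (\<forall>d\<in>edges G. unbounded (endpoints G) (F \<inter> - {d}) y)" if F: "F \<in> space M" for F
  proof -
    \<comment> \<open>\<open>core\<close> quantifies over a whole type, possibly uncountable. Values
      outside \<open>edges G\<close> delete nothing, so they all amount to the one condition with
      \<open>UNIV\<close>.\<close>
    have "F - {d} = (if d \<in> edges G then F \<inter> - {d} else F)" for d
      using F by (auto simp: space_M)
    \<comment> \<open>\<open>undefined\<close> is an arbitrary value of \<open>d\<close>: by
      monotonicity any instance of \<open>core\<close> makes the component of \<open>y\<close> in
      \<open>F\<close> infinite.\<close>
    then show ?thesis
      unfolding core_def Int_UNIV_right
      using unbounded_mono[of "endpoints G" "F - {undefined}" y F] by (metis Diff_subset)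
  qed
  then have "Measurable.pred M (\<lambda>F. core (endpoints G) F y) \<longleftrightarrow>
      Measurable.pred M (\<lambda>F. unbounded (endpoints G) (F \<inter> UNIV) y \<and>
        (\<forall>d\<in>edges G. unbounded (endpoints G) (F \<inter> - {d}) y))"
    by (rule measurable_cong)
  moreover have "\<dots>"
    by (intro pred_intros_logic(3) pred_countable_ball pred_unbounded assms countable_edges)
  ultimately show ?thesis by blast
qed

lemma pred_ends:
  assumes x: "x \<in> verts G"
  shows "Measurable.pred M (\<lambda>F. ends k (endpoints G) F x)"
proof -
  let ?g = "endpoints G" and ?Fin = "{K. finite K \<and> K \<subseteq> verts G}"
  have "ends k ?g F x \<longleftrightarrow> (\<exists>W\<in>?Fin. \<exists>D\<in>?Fin. (\<forall>w\<in>W. reach ?g (F \<inter> UNIV) x w) \<and> card D = k \<and>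
     (\<forall>a\<in>D. reach ?g (F \<inter> UNIV) x a \<and> unbounded ?g (F \<inter> off ?g UNIV W) a) \<and>
     (\<forall>a\<in>D. \<forall>b\<in>D. reach ?g (F \<inter> off ?g UNIV W) a b \<longrightarrow> a = b))" (is "_ \<longleftrightarrow> ?R F")
    if F: "F \<in> space M" for F
  proof -
    \<comment> \<open>Brings vertex deletion into the form of an intersection with a fixed edge set,
      as in \<open>pred_reach\<close>.\<close>
    have off: "F \<inter> off ?g UNIV W = off ?g F W" for W by (auto simp: off_def)
    have sub: "W \<subseteq> verts G" if "\<forall>w\<in>W. reach ?g F x w" for W
      using reach_verts[of F x] x F that by (auto simp: space_M)
    show ?thesis
    proof
      assume "ends k ?g F x"
      then obtain W D where W: "finite W" "\<forall>w\<in>W. reach ?g F x w" and D: "finite D" "card D = k"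
        "\<forall>a\<in>D. reach ?g F x a \<and> unbounded ?g (off ?g F W) a"
        "\<forall>a\<in>D. \<forall>b\<in>D. reach ?g (off ?g F W) a b \<longrightarrow> a = b"
        unfolding ends_def by (elim exE conjE) (rule that)
      then show "?R F" using sub[of W] sub[of D]
        by (rule_tac bexI[of _ W], rule_tac bexI[of _ D]) (simp_all add: off)
    next
      assume "?R F"
      then obtain W D where "finite W" "finite D" "\<forall>w\<in>W. reach ?g F x w" "card D = k"
        "\<forall>a\<in>D. reach ?g F x a \<and> unbounded ?g (off ?g F W) a"
        "\<forall>a\<in>D. \<forall>b\<in>D. reach ?g (off ?g F W) a b \<longrightarrow> a = b"
        unfolding off Int_UNIV_right mem_Collect_eq by (elim bexE conjE CollectE) (rule that)
      then show "ends k ?g F x" unfolding ends_def by (rule_tac exI[of _ W], rule_tac exI[of _ D]) simp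
    qed
  qed
  moreover have "Measurable.pred M ?R"
    by (intro pred_countable_bex pred_countable_ball pred_intros_logic(3) pred_intros_imp' pred_intros_conj1'
        pred_intros_logic(4) countable_finite_verts pred_reach pred_unbounded)
      (auto intro: countable_finite)
  ultimately show ?thesis by (subst measurable_cong) auto
qed

section \<open>Walking through \<open>G\<close> from one component to the other\<close>

definition joinable :: "'v \<Rightarrow> 'v \<Rightarrow> 'e set set" where
  "joinable u y = {F \<in> space M. ends 2 (endpoints G) F u \<and> core (endpoints G) F y \<and> \<not> reach (endpoints G) F u y}"

lemma reach_event: "{F \<in> space M. reach (endpoints G) F a b} \<in> sets M"
  using pred_reach[of UNIV a b] by (simp add: pred_def)

lemma joinable_event:
  assumes "u \<in> verts G" "y \<in> verts G"
  shows "joinable u y \<in> sets M"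
  unfolding joinable_def
  using pred_ends[OF assms(1)] pred_core[OF assms(2)] reach_event
  by (intro sets.sets_Collect_conj sets.sets_Collect_neg) (auto simp: pred_def)

text \<open>Where \<open>v\<close> already lies in the component of \<open>u\<close>, nothing has to
  change; elsewhere an exchange along \<open>e\<close> attaches it. For \<open>v = y\<close> the
  event \<open>joinable v y\<close> is empty, which leaves only the third end.\<close>

lemma joinable_step:
  assumes e: "e \<in> edges G" "endpoints G e = {v, u}" and verts: "u \<in> verts G" "v \<in> verts G" "y \<in> verts G"
    and pos: "measure M (joinable u y) > 0"
  shows "measure M (joinable v y) > 0 \<or> \<P>(F in M. ends 3 (endpoints G) F v) > 0"
proof -
  let ?g = "endpoints G"
  define R where "R = {F \<in> space M. reach ?g F u v}"
  have R: "R \<in> sets M" unfolding R_def by (rule reach_event)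
  note J = joinable_event[OF verts(1,3)] joinable_event[OF verts(2,3)]
  have ends3: "{F \<in> space M. ends 3 ?g F v} \<in> sets M" using pred_ends[OF verts(2)] by (simp add: pred_def)
  consider (same) "measure M (joinable u y \<inter> R) > 0" | (apart) "measure M (joinable u y - R) > 0"
  proof -
    have "measure M (joinable u y) = measure M (joinable u y \<inter> R) + measure M (joinable u y - R)"
      using M.finite_measure_Union[of "joinable u y \<inter> R" "joinable u y - R"] J R
      by (simp add: Int_Diff_Un Int_Diff_disjoint)
    then show ?thesis using pos that measure_nonneg[of M] by (smt (verit))
  qed
  then show ?thesis
  proof cases
    case same
    have "joinable u y \<inter> R \<subseteq> joinable v y"
      unfolding joinable_def R_def using ends_reach reach_trans by fast
    then have "measure M (joinable u y \<inter> R) \<le> measure M (joinable v y)"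
      using J by (intro M.finite_measure_mono)
    then show ?thesis using same by simp
  next
    case apart
    have uv: "u \<noteq> v"
    proof
      assume "u = v"
      then have "joinable u y - R = {}" by (auto simp: R_def joinable_def)
      then have "measure M (joinable u y - R) = 0" by (simp only: measure_empty)
      then show False using apart by simp
    qed
    have e': "endpoints G e = {u, v}" using e by (simp add: insert_commute)
    have avoid: "e \<notin> F" if "F \<in> joinable u y - R" for F
      using that reach_edge[of e F ?g u v] e' by (auto simp: R_def joinable_def)
    obtain d where d: "d \<in> edges G" "v \<in> ?g d"
      "\<P>(F in M. e \<in> F \<and> d \<notin> F \<and> insert d (F - {e}) \<in> joinable u y - R) > 0"
      using edge_exchange[OF e(1) e' uv _ apart avoid] J R by auto
    obtain p q where "?g d = {p, q}" using endpoints_verts[OF d(1)] by blast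
    \<comment> \<open>The other endpoint of \<open>d\<close>, which is \<open>v\<close> itself if
      \<open>d\<close> is a loop.\<close>
    then have z: "?g d = {v, if v = p then q else p}" using d(2) by auto
    have "{F \<in> space M. e \<in> F \<and> d \<notin> F \<and> insert d (F - {e}) \<in> joinable u y - R} \<subseteq>
        {F \<in> space M. ends 3 ?g F v} \<union> joinable v y"
    proof
      fix F' assume F': "F' \<in> {F \<in> space M. e \<in> F \<and> d \<notin> F \<and> insert d (F - {e}) \<in> joinable u y - R}"
      \<comment> \<open>\<open>F\<close> is the configuration before the exchange, recovered from
        \<open>F'\<close>.\<close>
      define F where "F = insert d (F' - {e})"
      have F: "F \<in> joinable u y" "F \<notin> R" "F \<subseteq> edges G" and eq: "F' = insert e (F - {d})"
        using F' by (auto simp: F_def joinable_def space_M)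
      have "finite {x \<in> F. u \<in> ?g x}"
        using F(3) by (intro finite_subset[OF _ locally_finite[OF verts(1)]]) auto
      then have "ends (Suc 2) ?g F' v \<or> ends 2 ?g F' v \<and> core ?g F' y \<and> \<not> reach ?g F' v y"
        using F by (intro attach_end[OF _ _ _ _ z e' _ eq]) (auto simp: joinable_def R_def)
      then show "F' \<in> {F \<in> space M. ends 3 ?g F v} \<union> joinable v y"
        using F' by (auto simp: joinable_def numeral_3_eq_3 numeral_2_eq_2)
    qed
    then have "\<P>(F in M. e \<in> F \<and> d \<notin> F \<and> insert d (F - {e}) \<in> joinable u y - R) \<le>
        measure M ({F \<in> space M. ends 3 ?g F v} \<union> joinable v y)"
      using J ends3 by (intro M.finite_measure_mono) auto
    also have "\<dots> \<le> \<P>(F in M. ends 3 ?g F v) + measure M (joinable v y)"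
      using J ends3 by (intro measure_Un_le) auto
    finally show ?thesis using d(3) by linarith
  qed
qed

text \<open>Induction along a walk from \<open>y\<close> back to \<open>x\<close>. At
  \<open>y\<close> the event \<open>joinable y y\<close> is empty, so positivity is lost somewhere
  on the way, and a step allows this only by producing a third end.\<close>

lemma joinable_three_ends:
  assumes verts: "x \<in> verts G" "y \<in> verts G" and pos: "measure M (joinable x y) > 0"
  shows "\<exists>v\<in>verts G. \<P>(F in M. ends 3 (endpoints G) F v) > 0"
proof -
  have "reach (endpoints G) (edges G) y x"
    using connected verts by (auto simp: connected_graph_def linked_def adj_def reach_def)
  then have "measure M (joinable x y) > 0 \<longrightarrow> ?thesis"
  proof (induction rule: reach_induct)
    case refl
    have "joinable y y = {}" by (simp add: joinable_def)
    then show ?case by simp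
  next
    case (step v u e)
    have v: "v \<in> verts G" using reach_verts[OF order_refl step(1) verts(2)] .
    have "u \<in> verts G" using endpoints_verts[OF step(2)] step(3) by (auto simp: doubleton_eq_iff)
    then show ?case using joinable_step[OF step(2,3) _ v verts(2)] step.IH v by blast
  qed
  then show ?thesis using pos by blast
qed

text \<open>Any vertex may represent the first component. In the second,
  \<open>ends_two_core\<close> replaces \<open>y\<close> by a vertex on a bi-infinite path, a
  property that later exchanges can preserve.\<close>

lemma two_components_joinable:
  assumes F: "F \<in> space M" and A: "A \<in> forest_components G F" and B: "B \<in> forest_components G F"
    and "A \<noteq> B" and A2: "ends_at_least 2 A" and B2: "ends_at_least 2 B"
  shows "\<exists>x\<in>verts G. \<exists>y\<in>verts G. F \<in> joinable x y"
proof -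
  let ?g = "endpoints G" and ?A = "\<lambda>x. induced (spanning_subgraph G F) {b. reach (endpoints G) F x b}"
  have sub: "F \<subseteq> edges G" using F by (simp add: space_M)
  obtain x where x: "x \<in> verts G" "A = ?A x" using A forest_components_eq[OF sub] by auto
  obtain y where y: "y \<in> verts G" "B = ?A y" using B forest_components_eq[OF sub] by auto
  have xy: "\<not> reach ?g F x y"
  proof
    assume r: "reach ?g F x y"
    then have "{b. reach ?g F x b} = {b. reach ?g F y b}"
      using reach_common[OF r] reach_trans[OF r] by blast
    then show False using \<open>A \<noteq> B\<close> x y by simp
  qed
  have "ends 2 ?g F y" using B2 y(2) by (simp add: ends_at_least_iff)
  moreover have "\<exists>u v. ?g e = {u, v}" if "e \<in> F" for e using that sub endpoints_verts by blast
  ultimately obtain y' where y': "reach ?g F y y'" "core ?g F y'" using ends_two_core by metis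
  have "\<not> reach ?g F x y'" using xy reach_trans[OF _ reach_sym[OF y'(1)]] by blast
  moreover have "ends 2 ?g F x" using A2 x(2) by (simp add: ends_at_least_iff)
  moreover have "y' \<in> verts G" using reach_verts[OF sub y'(1) y(1)] .
  ultimately show ?thesis using F x(1) y'(2) by (auto simp: joinable_def)
qed

lemma two_two_ended_imp_three_ended:
  assumes "\<P>(F in M. \<exists>A \<in> forest_components G F. \<exists>B \<in> forest_components G F.
           A \<noteq> B \<and> k_ended 2 A \<and> k_ended 2 B) > 0"
  shows "\<P>(F in M. \<exists>A \<in> forest_components G F. ends_at_least 3 A) > 0"
proof -
  let ?J = "\<Union>(x, y)\<in>verts G \<times> verts G. joinable x y"
  \<comment> \<open>Otherwise the countable union over pairs of vertices would be a null set
    containing the event assumed to be of positive probability.\<close>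
  have "\<exists>x\<in>verts G. \<exists>y\<in>verts G. measure M (joinable x y) > 0"
  proof (rule ccontr)
    assume "\<not> ?thesis"
    then have "joinable x y \<in> null_sets M" if "x \<in> verts G" "y \<in> verts G" for x y
      using that joinable_event measure_nonneg[of M "joinable x y"]
      by (intro null_setsI) (auto simp: M.emeasure_eq_measure order_less_le)
    then have null: "?J \<in> null_sets M"
      by (intro null_sets_UN') (auto intro: countable_verts)
    have "{F \<in> space M. \<exists>A \<in> forest_components G F. \<exists>B \<in> forest_components G F.
        A \<noteq> B \<and> k_ended 2 A \<and> k_ended 2 B} \<subseteq> ?J"
      using two_components_joinable by (fastforce simp: k_ended_def)
    then have "\<P>(F in M. \<exists>A \<in> forest_components G F. \<exists>B \<in> forest_components G F.
        A \<noteq> B \<and> k_ended 2 A \<and> k_ended 2 B) \<le> measure M ?J"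
      using null by (intro M.finite_measure_mono) auto
    also have "\<dots> = 0" using null by (simp add: measure_eq_0_null_sets)
    finally show False using assms by simp
  qed
  then obtain v where v: "v \<in> verts G" "\<P>(F in M. ends 3 (endpoints G) F v) > 0"
    using joinable_three_ends by blast
  \<comment> \<open>Indexing components by vertices makes this event a countable union, hence
    measurable, and it contains the event found for \<open>v\<close>.\<close>
  have "(\<exists>A \<in> forest_components G F. ends_at_least 3 A) \<longleftrightarrow> (\<exists>x\<in>verts G. ends 3 (endpoints G) F x)"
    if "F \<in> space M" for F
    using that by (simp add: space_M forest_components_eq ends_at_least_iff)
  then have eq: "{F \<in> space M. \<exists>A \<in> forest_components G F. ends_at_least 3 A} =
      (\<Union>x\<in>verts G. {F \<in> space M. ends 3 (endpoints G) F x})"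
    by blast
  have "{F \<in> space M. ends 3 (endpoints G) F x} \<in> sets M" if "x \<in> verts G" for x
    using pred_ends[OF that] by (simp add: pred_def)
  then have "(\<Union>x\<in>verts G. {F \<in> space M. ends 3 (endpoints G) F x}) \<in> sets M"
    by (intro sets.countable_UN' countable_verts) auto
  then have "\<P>(F in M. ends 3 (endpoints G) F v) \<le> measure M (\<Union>x\<in>verts G. {F \<in> space M. ends 3 (endpoints G) F x})"
    using v(1) by (intro M.finite_measure_mono) auto
  then show ?thesis using v(2) unfolding eq by simp
qed

end

theorem theorem3:
  fixes G :: "('v, 'e) mgraph" and c :: "'e \<Rightarrow> real" and M :: "'e set measure"
  assumes "network G c"
    and "infinite (verts G)"
    and "wusf_law G c M"
    and "\<P>(F in M. \<exists>A \<in> forest_components G F. \<exists>B \<in> forest_components G F.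
           A \<noteq> B \<and> k_ended 2 A \<and> k_ended 2 B) > 0"
  shows "\<P>(F in M. \<exists>A \<in> forest_components G F. ends_at_least 3 A) > 0"
proof -
  obtain X where "wired_limit G c M X"
    using assms(1,3) by (auto simp: wusf_law_def wired_limit_def wired_limit_axioms_def)
  then show ?thesis using assms(4) by (rule wired_limit.two_two_ended_imp_three_ended)
qed

end
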